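(* Let $L=\{0,+,-\}$ be the three-element monoid with identity $0$ and two left zeroes $+,-$, and let $ZL$ be the four-element monoid obtained by adjoining a multiplicative zero to $L$. Then neither of the quasivarieties $\mathrm{qv}(L)$ and $\mathrm{qv}(ZL)$ of semigroups has a finite basis of quasi-identities, but for each of them there is a polynomial time algorithm which, given a finite semigroup $T$, decides whether $T$ belongs to the quasivariety.
   Context: In $L$, the element $0$ is the identity and $xy=x$ for all $x\in\{+,-\}$ and $y\in L$. In $ZL$ there is an additional element $z$ with $zx=xz=z$ for all $x$. A (semigroup) quasi-identity is a universally quantified formal implication $(u_1=v_1)\wedge\cdots\wedge(u_n=v_n)\Rightarrow u=v$ where $u_i,v_i,u,v$ are words over some alphabet of variables. A quasivariety is a class of semigroups defined by a set of quasi-identities; it is finitely based (has a finite basis of quasi-identities) if it is the class of all semigroups satisfying some finite set of quasi-identities. For a finite semigroup $S$, $\mathrm{qv}(S)$ denotes the quasivariety generated by $S$; it consists of all semigroups isomorphic to a subsemigroup of a direct power of $S$, equivalently of all semigroups $T$ such that the homomorphisms $T\to S$ separate the points of $T$. Polynomial time is measured in terms of $|T|$, where the finite semigroup $T$ is given by its multiplication table. *)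

theory Defs
  imports
    "HOL-Algebra.Congruence"
    "HOL-Library.FuncSet"
    "HOL-Library.Infinite_Typeclass"
    "HOL-Computational_Algebra.Polynomial"
begin

record 'a sgrp = "'a partial_object" +
  prod_op :: "'a \<Rightarrow> 'a \<Rightarrow> 'a" (infixl "\<cdot>\<index>" 70)

locale semigrp =
  fixes S :: "'a sgrp" (structure)
  assumes nonempty: "carrier S \<noteq> {}"
    and closed: "\<lbrakk>x \<in> carrier S; y \<in> carrier S\<rbrakk> \<Longrightarrow> x \<cdot> y \<in> carrier S"
    and assoc: "\<lbrakk>x \<in> carrier S; y \<in> carrier S; z \<in> carrier S\<rbrakk> \<Longrightarrow> (x \<cdot> y) \<cdot> z = x \<cdot> (y \<cdot> z)"

definition sg_hom :: "'a sgrp \<Rightarrow> 'b sgrp \<Rightarrow> ('a \<Rightarrow> 'b) set" where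
  "sg_hom S T = {h \<in> carrier S \<rightarrow> carrier T.
     \<forall>x\<in>carrier S. \<forall>y\<in>carrier S. h (x \<cdot>\<^bsub>S\<^esub> y) = h x \<cdot>\<^bsub>T\<^esub> h y}"

definition sg_isomorphic :: "'a sgrp \<Rightarrow> 'b sgrp \<Rightarrow> bool" where
  "sg_isomorphic S T \<longleftrightarrow> (\<exists>h\<in>sg_hom S T. bij_betw h (carrier S) (carrier T))"

definition subsemigroup :: "'a sgrp \<Rightarrow> 'a sgrp \<Rightarrow> bool" where
  "subsemigroup U S \<longleftrightarrow> semigrp U \<and> carrier U \<subseteq> carrier S \<and>
     (\<forall>x\<in>carrier U. \<forall>y\<in>carrier U. x \<cdot>\<^bsub>U\<^esub> y = x \<cdot>\<^bsub>S\<^esub> y)"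

definition direct_power :: "'s sgrp \<Rightarrow> 'i set \<Rightarrow> ('i \<Rightarrow> 's) sgrp" where
  "direct_power S I =
     \<lparr>carrier = I \<rightarrow>\<^sub>E carrier S, prod_op = (\<lambda>f g. \<lambda>i\<in>I. f i \<cdot>\<^bsub>S\<^esub> g i)\<rparr>"

text \<open>Words are nonempty; a quasi-identity involves only finitely many variables, so that
  natural numbers suffice as an alphabet.\<close>

datatype word = Letter nat | Cat nat word

primrec word_val :: "'a sgrp \<Rightarrow> (nat \<Rightarrow> 'a) \<Rightarrow> word \<Rightarrow> 'a" where
  "word_val S \<theta> (Letter x) = \<theta> x"
| "word_val S \<theta> (Cat x w) = \<theta> x \<cdot>\<^bsub>S\<^esub> word_val S \<theta> w"

datatype quasi_identity =
  Quasi_Identity (hypotheses: "(word \<times> word) list") (conclusion: "word \<times> word")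

definition satisfies :: "'a sgrp \<Rightarrow> quasi_identity \<Rightarrow> bool" where
  "satisfies S q \<longleftrightarrow> (\<forall>\<theta>. (\<forall>x. \<theta> x \<in> carrier S) \<longrightarrow>
     (\<forall>(u, v)\<in>set (hypotheses q). word_val S \<theta> u = word_val S \<theta> v) \<longrightarrow>
     (case conclusion q of (u, v) \<Rightarrow> word_val S \<theta> u = word_val S \<theta> v))"

text \<open>
  A class of semigroups is represented by its members whose carrier is a set of elements of the
  type \<open>'a\<close>. If \<open>\<Sigma>\<close> axiomatizes a class among all semigroups, then it does so
  among those with carrier in \<open>'a\<close>; hence refuting \<open>finitely_based\<close> for a given
  \<open>'a\<close> refutes the existence of a finite basis for the whole class.
\<close>

definition models :: "quasi_identity set \<Rightarrow> 'a sgrp set" where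
  "models \<Sigma> = {T. semigrp T \<and> (\<forall>q\<in>\<Sigma>. satisfies T q)}"

definition finitely_based :: "'a sgrp set \<Rightarrow> bool" where
  "finitely_based K \<longleftrightarrow> (\<exists>\<Sigma>. finite \<Sigma> \<and> K = models \<Sigma>)"

text \<open>
  The index set of the power has to be drawn from some fixed type. The type of maps from
  \<open>T\<close> to \<open>S\<close> is large enough: see \<open>qv_if_embedded\<close> below, where the index type is arbitrary.
\<close>

definition qv :: "'s sgrp \<Rightarrow> 'a sgrp set" where
  "qv S = {T. semigrp T \<and>
     (\<exists>(I :: ('a \<Rightarrow> 's) set) U. subsemigroup U (direct_power S I) \<and> sg_isomorphic T U)}"

lemma separates_if_embedded:
  assumes U: "subsemigroup U (direct_power S I)" and iso: "sg_isomorphic T U"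
    and xy: "x \<in> carrier T" "y \<in> carrier T" "x \<noteq> y"
  shows "\<exists>h\<in>sg_hom T S. h x \<noteq> h y"
proof -
  obtain k where k: "k \<in> sg_hom T U" "bij_betw k (carrier T) (carrier U)"
    using iso by (auto simp: sg_isomorphic_def)
  have in_power: "k a \<in> I \<rightarrow>\<^sub>E carrier S" if "a \<in> carrier T" for a
    using that k U by (auto simp: sg_hom_def subsemigroup_def direct_power_def)
  have "k x \<noteq> k y"
    using k(2) xy by (auto simp: bij_betw_def inj_on_def)
  then obtain i where i: "i \<in> I" "k x i \<noteq> k y i"
    using in_power[OF xy(1)] in_power[OF xy(2)] by (meson PiE_ext)
  have "k (a \<cdot>\<^bsub>T\<^esub> b) i = k a i \<cdot>\<^bsub>S\<^esub> k b i" if "a \<in> carrier T" "b \<in> carrier T" for a b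
  proof -
    have "k a \<in> carrier U" "k b \<in> carrier U" "k (a \<cdot>\<^bsub>T\<^esub> b) = k a \<cdot>\<^bsub>U\<^esub> k b"
      using that k(1) by (auto simp: sg_hom_def)
    then show ?thesis
      using U i(1) by (auto simp: subsemigroup_def direct_power_def)
  qed
  then have "(\<lambda>a. k a i) \<in> sg_hom T S"
    using in_power i(1) by (auto simp: sg_hom_def)
  with i(2) show ?thesis by (intro bexI[of _ "\<lambda>a. k a i"]) auto
qed

lemma qv_iff_separates:
  fixes S :: "'s sgrp" and T :: "'a sgrp"
  shows "T \<in> qv S \<longleftrightarrow> semigrp T \<and>
    (\<forall>x\<in>carrier T. \<forall>y\<in>carrier T. x \<noteq> y \<longrightarrow> (\<exists>h\<in>sg_hom T S. h x \<noteq> h y))"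
proof
  assume "T \<in> qv S"
  then obtain I :: "('a \<Rightarrow> 's) set" and U
    where "semigrp T" "subsemigroup U (direct_power S I)" "sg_isomorphic T U"
    unfolding qv_def by blast
  then show "semigrp T \<and>
    (\<forall>x\<in>carrier T. \<forall>y\<in>carrier T. x \<noteq> y \<longrightarrow> (\<exists>h\<in>sg_hom T S. h x \<noteq> h y))"
    by (intro conjI ballI impI separates_if_embedded)
next
  assume R: "semigrp T \<and>
    (\<forall>x\<in>carrier T. \<forall>y\<in>carrier T. x \<noteq> y \<longrightarrow> (\<exists>h\<in>sg_hom T S. h x \<noteq> h y))"
  interpret T: semigrp T using R by blast
  define I where "I = sg_hom T S"
  define k where "k a = (\<lambda>h\<in>I. h a)" for a
  define U where "U = \<lparr>carrier = k ` carrier T, prod_op = prod_op (direct_power S I)\<rparr>"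
  have mult: "k a \<cdot>\<^bsub>U\<^esub> k b = k (a \<cdot>\<^bsub>T\<^esub> b)" if "a \<in> carrier T" "b \<in> carrier T" for a b
    using that by (auto simp: U_def direct_power_def k_def I_def sg_hom_def fun_eq_iff)
  have "semigrp U"
  proof
    show "carrier U \<noteq> {}" using T.nonempty by (simp add: U_def)
  next
    fix f g assume "f \<in> carrier U" "g \<in> carrier U"
    then obtain a b where "a \<in> carrier T" "b \<in> carrier T" "f = k a" "g = k b"
      by (auto simp: U_def)
    then show "f \<cdot>\<^bsub>U\<^esub> g \<in> carrier U"
      using mult T.closed by (simp add: U_def)
  next
    fix f g e assume "f \<in> carrier U" "g \<in> carrier U" "e \<in> carrier U"
    then obtain a b c where "a \<in> carrier T" "b \<in> carrier T" "c \<in> carrier T"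
      "f = k a" "g = k b" "e = k c"
      by (auto simp: U_def)
    then show "f \<cdot>\<^bsub>U\<^esub> g \<cdot>\<^bsub>U\<^esub> e = f \<cdot>\<^bsub>U\<^esub> (g \<cdot>\<^bsub>U\<^esub> e)"
      using mult T.closed T.assoc by simp
  qed
  moreover have "h a \<in> carrier S" if "h \<in> I" "a \<in> carrier T" for h a
    using that by (auto simp: I_def sg_hom_def)
  then have "carrier U \<subseteq> carrier (direct_power S I)"
    by (auto simp: U_def direct_power_def k_def split: if_splits)
  ultimately have "subsemigroup U (direct_power S I)"
    by (auto simp: subsemigroup_def U_def)
  moreover have "sg_isomorphic T U"
    unfolding sg_isomorphic_def
  proof
    show "k \<in> sg_hom T U"
      using mult by (auto simp: sg_hom_def U_def)
    have "inj_on k (carrier T)"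
    proof (rule inj_onI, rule ccontr)
      fix x y assume xy: "x \<in> carrier T" "y \<in> carrier T" "k x = k y" "x \<noteq> y"
      then obtain h where h: "h \<in> I" "h x \<noteq> h y" using R by (auto simp: I_def)
      have "k x h = k y h" using xy(3) by simp
      with h show False by (simp add: k_def)
    qed
    then show "bij_betw k (carrier T) (carrier U)"
      by (simp add: bij_betw_def U_def)
  qed
  ultimately show "T \<in> qv S"
    using R unfolding qv_def by blast
qed

lemma qv_if_embedded:
  fixes I :: "'i set"
  assumes "semigrp T" "subsemigroup U (direct_power S I)" "sg_isomorphic T U"
  shows "T \<in> qv S"
  unfolding qv_iff_separates
  by (intro conjI ballI impI assms(1) separates_if_embedded[OF assms(2,3)])

text \<open>\<open>Zero\<close> stands for the identity \<open>0\<close> of \<open>L\<close>, not for a multiplicative zero.\<close>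

datatype sign = Zero | Plus | Minus

fun sign_mult :: "sign \<Rightarrow> sign \<Rightarrow> sign" where
  "sign_mult Zero y = y"
| "sign_mult Plus y = Plus"
| "sign_mult Minus y = Minus"

definition L :: "sign sgrp" where
  "L = \<lparr>carrier = UNIV, prod_op = sign_mult\<rparr>"

fun option_mult :: "('a \<Rightarrow> 'a \<Rightarrow> 'a) \<Rightarrow> 'a option \<Rightarrow> 'a option \<Rightarrow> 'a option" where
  "option_mult f (Some x) (Some y) = Some (f x y)"
| "option_mult f _ _ = None"

text \<open>The adjoined multiplicative zero is \<open>None\<close>.\<close>

definition adjoin_zero :: "'a sgrp \<Rightarrow> 'a option sgrp" where
  "adjoin_zero S =
     \<lparr>carrier = insert None (Some ` carrier S), prod_op = option_mult (prod_op S)\<rparr>"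

definition ZL :: "sign option sgrp" where
  "ZL = adjoin_zero L"

lemma semigrp_L: "semigrp L"
proof
  fix x y z
  show "x \<cdot>\<^bsub>L\<^esub> y \<cdot>\<^bsub>L\<^esub> z = x \<cdot>\<^bsub>L\<^esub> (y \<cdot>\<^bsub>L\<^esub> z)"
    by (cases x) (simp_all add: L_def)
qed (simp_all add: L_def)

lemma semigrp_adjoin_zero:
  assumes "semigrp S"
  shows "semigrp (adjoin_zero S)"
proof -
  interpret semigrp S by (fact assms)
  show ?thesis
    by standard (auto simp: adjoin_zero_def closed assoc)
qed

lemma semigrp_ZL: "semigrp ZL"
  unfolding ZL_def by (intro semigrp_adjoin_zero semigrp_L)

text \<open>
  The machine model consists of while-programs over a random access memory of natural numbers with
  indirect addressing, the arithmetic operations being addition and truncated subtraction. Each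
  elementary instruction and each test takes one unit of time. In the absence of multiplication,
  the binary length of the stored numbers grows by at most a constant (depending on the
  program) in each step, so that polynomial time on this model is polynomial time on Turing
  machines.
\<close>

type_synonym memory = "nat \<Rightarrow> nat"

datatype expr = Const nat | Cell expr | Add expr expr | Sub expr expr

primrec expr_val :: "expr \<Rightarrow> memory \<Rightarrow> nat" where
  "expr_val (Const c) s = c"
| "expr_val (Cell e) s = s (expr_val e s)"
| "expr_val (Add d e) s = expr_val d s + expr_val e s"
| "expr_val (Sub d e) s = expr_val d s - expr_val e s"

datatype program =
    Skip
  | Store expr expr
  | Seq program program
  | Cond expr program program
  | While expr program

text \<open>\<open>exec c s t s'\<close>: started in memory \<open>s\<close>, the program \<open>c\<close> halts after \<open>t\<close> steps in
  memory \<open>s'\<close>. Tests succeed on nonzero values.\<close>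

inductive exec :: "program \<Rightarrow> memory \<Rightarrow> nat \<Rightarrow> memory \<Rightarrow> bool" where
  Skip: "exec Skip s 1 s"
| Store: "exec (Store d e) s 1 (s(expr_val d s := expr_val e s))"
| Seq: "\<lbrakk>exec c s t s'; exec c' s' t' s''\<rbrakk> \<Longrightarrow> exec (Seq c c') s (t + t') s''"
| Cond_True: "\<lbrakk>expr_val e s \<noteq> 0; exec c s t s'\<rbrakk> \<Longrightarrow> exec (Cond e c c') s (t + 1) s'"
| Cond_False: "\<lbrakk>expr_val e s = 0; exec c' s t s'\<rbrakk> \<Longrightarrow> exec (Cond e c c') s (t + 1) s'"
| While_False: "expr_val e s = 0 \<Longrightarrow> exec (While e c) s 1 s"
| While_True: "\<lbrakk>expr_val e s \<noteq> 0; exec c s t s'; exec (While e c) s' t' s''\<rbrakk> \<Longrightarrow>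
    exec (While e c) s (t + t' + 1) s''"

lemma exec_deterministic:
  "exec c s t s' \<Longrightarrow> exec c s u s'' \<Longrightarrow> t = u \<and> s' = s''"
proof (induction arbitrary: u s'' rule: exec.induct)
  case (Skip s)
  then show ?case by (cases rule: exec.cases) simp
next
  case (Store d e s)
  then show ?case by (cases rule: exec.cases) simp
next
  case (Seq c s t s' c' t' r)
  from Seq.prems show ?case by (cases rule: exec.cases) (use Seq.IH in blast)+
next
  case (Cond_True e s c t s' c')
  from Cond_True.prems show ?case by (cases rule: exec.cases) (use Cond_True in blast)+
next
  case (Cond_False e s c' t s' c)
  from Cond_False.prems show ?case by (cases rule: exec.cases) (use Cond_False in blast)+
next
  case (While_False e s c)
  from While_False.prems show ?case by (cases rule: exec.cases) (use While_False in blast)+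
next
  case (While_True e s c t s' t' r)
  from While_True.prems show ?case
    by (cases rule: exec.cases) (use While_True in blast)+
qed

text \<open>A semigroup with elements \<open>0, \<dots>, n - 1\<close> is input by its order \<open>n\<close> in cell \<open>0\<close> followed by
  its multiplication table, row by row: the product of \<open>i\<close> and \<open>j\<close> is in cell \<open>1 + i * n + j\<close>.\<close>

definition table_memory :: "nat \<Rightarrow> nat sgrp \<Rightarrow> memory" where
  "table_memory n T a =
     (if a = 0 then n
      else if a \<le> n * n then ((a - 1) div n) \<cdot>\<^bsub>T\<^esub> ((a - 1) mod n)
      else 0)"

lemma table_memory_entry:
  assumes "i < n" "j < n"
  shows "table_memory n T (1 + i * n + j) = i \<cdot>\<^bsub>T\<^esub> j"
proof -
  have "i * n + j < n * n"
    using assms mult_le_mono1[of "Suc i" n n] by simp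
  then show ?thesis
    using assms by (simp add: table_memory_def)
qed

definition poly_time_decidable :: "nat sgrp set \<Rightarrow> bool" where
  "poly_time_decidable K \<longleftrightarrow> (\<exists>c (p :: nat poly). \<forall>n (T :: nat sgrp).
     semigrp T \<and> carrier T = {..<n} \<longrightarrow>
     (\<exists>t s. exec c (table_memory n T) t s \<and> t \<le> poly p n \<and> (s 0 \<noteq> 0 \<longleftrightarrow> T \<in> K)))"

end

theory Submission
  imports Defs
begin

text \<open>
  For the absence of a finite basis, take an antipodal cycle of length \<open>2m\<close> in the \<open>m\<close>-cube and cut
  it open at one vertex. The vertices of the resulting path, as left zeroes, and its edges form a
  semigroup \<open>T\<close>. A homomorphism from \<open>T\<close> to \<open>ZL\<close> either reads off the side of a hyperplane of the
  cube or is constant along every edge, so it cannot separate the two ends of the path. Once any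
  edge is removed, however, the path falls apart and the remaining subsemigroup is in \<open>qv L\<close>. As
  fewer than \<open>2m\<close> elements miss some edge, \<open>T\<close> satisfies all quasi-identities of \<open>qv L\<close> in fewer than
  \<open>2m\<close> variables.

  For the algorithm, a homomorphism from \<open>T\<close> to \<open>L\<close> is given by the filter \<open>Z\<close> mapped to the
  identity, together with a two-colouring of the other elements that gives \<open>s \<cdot> t\<close> the colour of \<open>t\<close> if
  \<open>s \<in> Z\<close> and that of \<open>s\<close> otherwise. A finite left regular band has only linearly many filters,
  since the nonempty ones are principal; for each of them it remains to compute the connected
  components of a graph on \<open>T\<close>.
\<close>

subsection \<open>Quasivarieties without a finite basis\<close>

primrec letters :: "word \<Rightarrow> nat set" where
  "letters (Letter x) = {x}"
| "letters (Cat x w) = insert x (letters w)"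

lemma finite_letters: "finite (letters w)"
  by (induction w) auto

definition qi_letters :: "quasi_identity \<Rightarrow> nat set" where
  "qi_letters q = (\<Union>(u, v)\<in>insert (conclusion q) (set (hypotheses q)). letters u \<union> letters v)"

lemma finite_qi_letters: "finite (qi_letters q)"
  unfolding qi_letters_def by (auto simp: finite_letters split: prod.splits)

lemma word_val_closed:
  assumes "semigrp U" "\<And>x. x \<in> letters w \<Longrightarrow> \<theta> x \<in> carrier U"
  shows "word_val U \<theta> w \<in> carrier U"
  using assms(2) by (induction w) (auto intro: semigrp.closed[OF assms(1)])

lemma word_val_subsemigroup:
  assumes U: "subsemigroup U T"
    and eq: "\<And>x. x \<in> letters w \<Longrightarrow> \<eta> x = \<theta> x" "\<And>x. x \<in> letters w \<Longrightarrow> \<theta> x \<in> carrier U"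
  shows "word_val U \<eta> w = word_val T \<theta> w"
  using eq
proof (induction w)
  case (Cat x w)
  have "word_val U \<eta> w \<in> carrier U"
    using Cat.prems U by (intro word_val_closed) (auto simp: subsemigroup_def)
  with Cat U show ?case by (auto simp: subsemigroup_def)
qed simp

text \<open>A finite basis mentions only finitely many variables. An assignment that refutes one of
  its members in \<open>T\<close> takes boundedly many values, so these lie in some \<open>U\<close>
  from \<open>K\<close>; there the member holds, but the same assignment would refute it.\<close>

lemma not_finitely_based_if_local:
  fixes K :: "'a sgrp set"
  assumes local: "\<And>n. \<exists>T. semigrp T \<and> T \<notin> K \<and>
    (\<forall>X\<subseteq>carrier T. finite X \<longrightarrow> card X \<le> n \<longrightarrow> (\<exists>U\<in>K. subsemigroup U T \<and> X \<subseteq> carrier U))"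
  shows "\<not> finitely_based K"
proof
  assume "finitely_based K"
  then obtain \<Sigma> where fin: "finite \<Sigma>" and K: "K = models \<Sigma>"
    by (auto simp: finitely_based_def)
  \<comment> \<open>The sum bounds the number of letters of each member, and makes sense also for
    empty \<open>\<Sigma>\<close>.\<close>
  define n where "n = (\<Sum>q\<in>\<Sigma>. card (qi_letters q))"
  obtain T where T: "semigrp T" "T \<notin> K" and
    sub: "\<And>X. X \<subseteq> carrier T \<Longrightarrow> finite X \<Longrightarrow> card X \<le> n \<Longrightarrow>
      \<exists>U\<in>K. subsemigroup U T \<and> X \<subseteq> carrier U"
    using local[of n] by blast
  obtain q where q: "q \<in> \<Sigma>" "\<not> satisfies T q"
    using T K by (auto simp: models_def)
  define holds where
    "holds U \<theta> p \<longleftrightarrow> word_val U \<theta> (fst p) = word_val U \<theta> (snd p)" for U :: "'a sgrp" and \<theta> p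
  have sat: "satisfies U q \<longleftrightarrow> (\<forall>\<theta>. (\<forall>x. \<theta> x \<in> carrier U) \<longrightarrow>
      (\<forall>p\<in>set (hypotheses q). holds U \<theta> p) \<longrightarrow> holds U \<theta> (conclusion q))" for U :: "'a sgrp"
    by (simp add: satisfies_def holds_def case_prod_beta)
  obtain \<theta> where \<theta>: "\<forall>x. \<theta> x \<in> carrier T"
    and hyp: "\<forall>p\<in>set (hypotheses q). holds T \<theta> p" and con: "\<not> holds T \<theta> (conclusion q)"
    using q(2) unfolding sat by blast
  have "card (\<theta> ` qi_letters q) \<le> card (qi_letters q)"
    by (intro card_image_le finite_qi_letters)
  also have "\<dots> \<le> n"
    unfolding n_def by (rule member_le_sum) (use q fin in auto)
  finally obtain U where U: "U \<in> K" "subsemigroup U T" "\<theta> ` qi_letters q \<subseteq> carrier U"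
    using sub[of "\<theta> ` qi_letters q"] \<theta> finite_qi_letters by blast
  then obtain c where c: "c \<in> carrier U"
    by (auto simp: subsemigroup_def dest!: semigrp.nonempty)
  \<comment> \<open>\<open>satisfies\<close> speaks of total assignments, so letters outside
    \<open>q\<close> get the default value \<open>c\<close>.\<close>
  define \<eta> where "\<eta> x = (if x \<in> qi_letters q then \<theta> x else c)" for x
  have eval: "word_val U \<eta> w = word_val T \<theta> w" if "letters w \<subseteq> qi_letters q" for w
    by (rule word_val_subsemigroup[OF U(2)]) (use that U(3) in \<open>auto simp: \<eta>_def\<close>)
  have eval': "holds U \<eta> p = holds T \<theta> p" if "p \<in> insert (conclusion q) (set (hypotheses q))" for p
  proof -
    have "letters (fst p) \<union> letters (snd p) \<subseteq> qi_letters q"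
      using that unfolding qi_letters_def case_prod_beta by blast
    then show ?thesis by (simp add: holds_def eval)
  qed
  have "\<forall>x. \<eta> x \<in> carrier U" using U(3) c by (auto simp: \<eta>_def)
  moreover have "satisfies U q" using U(1) q(1) K by (auto simp: models_def)
  ultimately have "holds U \<eta> (conclusion q)"
    unfolding sat using hyp eval' by simp
  with con eval' show False by simp
qed

text \<open>For injective \<open>f\<close> an isomorphic copy of \<open>T\<close>. It moves the path
  semigroups, which live on \<open>node\<close>, to an arbitrary infinite type.\<close>

definition sgrp_image :: "('b \<Rightarrow> 'a) \<Rightarrow> 'b sgrp \<Rightarrow> 'a sgrp" where
  "sgrp_image f T = \<lparr>carrier = f ` carrier T, prod_op = (\<lambda>x y. f (inv f x \<cdot>\<^bsub>T\<^esub> inv f y))\<rparr>"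

lemma carrier_sgrp_image [simp]: "carrier (sgrp_image f T) = f ` carrier T"
  by (simp add: sgrp_image_def)

lemma mult_sgrp_image [simp]: "inj f \<Longrightarrow> f x \<cdot>\<^bsub>sgrp_image f T\<^esub> f y = f (x \<cdot>\<^bsub>T\<^esub> y)"
  by (simp add: sgrp_image_def)

lemma semigrp_sgrp_image: "inj f \<Longrightarrow> semigrp T \<Longrightarrow> semigrp (sgrp_image f T)"
  unfolding semigrp_def by (auto simp: inj_def)

lemma subsemigroup_sgrp_image:
  "inj f \<Longrightarrow> subsemigroup U T \<Longrightarrow> subsemigroup (sgrp_image f U) (sgrp_image f T)"
  unfolding subsemigroup_def by (auto simp: semigrp_sgrp_image)

lemma sgrp_image_in_qv_iff:
  fixes f :: "'b \<Rightarrow> 'a" and S :: "'s sgrp"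
  assumes f: "inj f" and T: "semigrp T"
  shows "sgrp_image f T \<in> qv S \<longleftrightarrow> T \<in> qv S"
proof
  assume "sgrp_image f T \<in> qv S"
  then have sep: "\<exists>h\<in>sg_hom (sgrp_image f T) S. h (f x) \<noteq> h (f y)"
    if "x \<in> carrier T" "y \<in> carrier T" "x \<noteq> y" for x y
    using that f unfolding qv_iff_separates carrier_sgrp_image by (blast dest: injD)
  have "h \<circ> f \<in> sg_hom T S" if "h \<in> sg_hom (sgrp_image f T) S" for h
    using that f by (auto simp: sg_hom_def Pi_def)
  with sep T show "T \<in> qv S" unfolding qv_iff_separates by (metis comp_apply)
next
  assume qv: "T \<in> qv S"
  have "h \<circ> inv f \<in> sg_hom (sgrp_image f T) S" if "h \<in> sg_hom T S" for h
    using that f by (auto simp: sg_hom_def Pi_def)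
  moreover have "\<exists>h\<in>sg_hom T S. h (inv f x) \<noteq> h (inv f y)"
    if "x \<in> f ` carrier T" "y \<in> f ` carrier T" "x \<noteq> y" for x y
    using that f qv unfolding qv_iff_separates by (metis imageE inv_f_f)
  ultimately show "sgrp_image f T \<in> qv S"
    using semigrp_sgrp_image[OF f T] unfolding qv_iff_separates carrier_sgrp_image
    by (metis comp_apply)
qed

section \<open>The semigroups \<open>L\<close> and \<open>ZL\<close>\<close>

lemma carrier_L [simp]: "carrier L = UNIV" and mult_L [simp]: "x \<cdot>\<^bsub>L\<^esub> y = sign_mult x y"
  by (simp_all add: L_def)

lemma carrier_ZL [simp]: "carrier ZL = UNIV"
  and mult_ZL [simp]: "x \<cdot>\<^bsub>ZL\<^esub> y = option_mult sign_mult x y"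
  by (auto simp: ZL_def adjoin_zero_def L_def UNIV_option_conv)

lemma sg_hom_L_iff: "h \<in> sg_hom T L \<longleftrightarrow>
    (\<forall>x\<in>carrier T. \<forall>y\<in>carrier T. h (x \<cdot>\<^bsub>T\<^esub> y) = sign_mult (h x) (h y))"
  by (simp add: sg_hom_def)

lemma sg_hom_ZL_iff: "h \<in> sg_hom T ZL \<longleftrightarrow>
    (\<forall>x\<in>carrier T. \<forall>y\<in>carrier T. h (x \<cdot>\<^bsub>T\<^esub> y) = option_mult sign_mult (h x) (h y))"
  by (simp add: sg_hom_def)

lemma qv_L_subset_qv_ZL: "qv L \<subseteq> qv ZL"
proof
  fix T :: "'a sgrp" assume "T \<in> qv L"
  moreover have "Some \<circ> h \<in> sg_hom T ZL" if "h \<in> sg_hom T L" for h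
    using that by (simp add: sg_hom_L_iff sg_hom_ZL_iff)
  ultimately show "T \<in> qv ZL"
    unfolding qv_iff_separates by (metis comp_apply option.inject)
qed

subsection \<open>Path semigroups\<close>

text \<open>
  The edge \<open>Edge i\<close> joins \<open>Vertex i\<close> and \<open>Vertex (i + 1)\<close> on a path that traverses an
  antipodal cycle of length \<open>2m\<close> in the \<open>m\<close>-cube once, the two ends being kept apart. The
  \<open>k\<close>-th hyperplane of the cube cuts exactly the edges \<open>k\<close> and \<open>k + m\<close>. An edge times a vertex is
  the end of the edge that lies on the same side as the vertex of the hyperplane cutting the edge.
\<close>

datatype node = Vertex nat | Edge nat

definition beyond :: "nat \<Rightarrow> nat \<Rightarrow> nat \<Rightarrow> bool" where
  "beyond m k a \<longleftrightarrow> k < a \<and> a \<le> k + m"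

definition near_end :: "nat \<Rightarrow> nat \<Rightarrow> nat \<Rightarrow> nat" where
  "near_end m i a = (if beyond m (i mod m) a = beyond m (i mod m) i then i else Suc i)"

text \<open>Two edges cut by the same hyperplane are left zeroes towards each other. Otherwise the
  right factor \<open>Edge j\<close> acts like \<open>Vertex j\<close>: both its ends lie on one
  side of the hyperplane cutting \<open>Edge i\<close>, so either end would do.\<close>

fun path_mult :: "nat \<Rightarrow> node \<Rightarrow> node \<Rightarrow> node" where
  "path_mult m (Vertex a) u = Vertex a"
| "path_mult m (Edge i) (Vertex a) = Vertex (near_end m i a)"
| "path_mult m (Edge i) (Edge j) =
     (if i mod m = j mod m then Edge i else Vertex (near_end m i j))"

definition path_nodes :: "nat \<Rightarrow> node set" where
  "path_nodes m = Vertex ` {..2 * m} \<union> Edge ` {..<2 * m}"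

definition path_sgrp :: "nat \<Rightarrow> nat set \<Rightarrow> node sgrp" where
  "path_sgrp m J = \<lparr>carrier = path_nodes m - Edge ` J, prod_op = path_mult m\<rparr>"

lemma carrier_path [simp]: "carrier (path_sgrp m J) = path_nodes m - Edge ` J"
  and mult_path [simp]: "x \<cdot>\<^bsub>path_sgrp m J\<^esub> y = path_mult m x y"
  by (simp_all add: path_sgrp_def)

lemma path_mult_closed:
  "x \<in> path_nodes m - Edge ` J \<Longrightarrow> y \<in> path_nodes m - Edge ` J \<Longrightarrow>
    path_mult m x y \<in> path_nodes m - Edge ` J"
  by (induction m x y rule: path_mult.induct) (auto simp: path_nodes_def near_end_def)

section \<open>Homomorphisms from path semigroups to \<open>L\<close>\<close>

definition sign_of :: "bool \<Rightarrow> sign" where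
  "sign_of b = (if b then Plus else Minus)"

lemma sign_of_simps [simp]: "sign_mult (sign_of b) x = sign_of b"
  "sign_of b = sign_of c \<longleftrightarrow> b = c" "sign_of b \<noteq> Zero" "Zero \<noteq> sign_of b"
  by (auto simp: sign_of_def)

primrec hyperplane_sign :: "nat \<Rightarrow> nat \<Rightarrow> node \<Rightarrow> sign" where
  "hyperplane_sign m k (Vertex a) = sign_of (beyond m k a)"
| "hyperplane_sign m k (Edge i) = (if i mod m = k then Zero else sign_of (beyond m k i))"

text \<open>Tells apart the two pieces left when \<open>Edge j\<close> is removed. Every other edge
  has both ends in its own piece: for \<open>i \<noteq> j\<close>, each of \<open>i \<le> j\<close>
  and \<open>Suc i \<le> j\<close> amounts to \<open>i < j\<close>.\<close>

primrec cut_sign :: "nat \<Rightarrow> node \<Rightarrow> sign" where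
  "cut_sign j (Vertex a) = sign_of (a \<le> j)"
| "cut_sign j (Edge i) = sign_of (i < j)"

lemma mod_eq_if_less_double:
  assumes "i < 2 * (m :: nat)"
  shows "i mod m = (if i < m then i else i - m)"
  using assms by (auto simp: mod_if)

lemma beyond_Suc:
  assumes "i < 2 * m" "k < m"
  shows "beyond m k (Suc i) = beyond m k i \<longleftrightarrow> i mod m \<noteq> k"
  using assms unfolding mod_eq_if_less_double[OF assms(1)] beyond_def by auto

lemma hyperplane_sign_hom:
  assumes k: "k < m" and x: "x \<in> path_nodes m" and y: "y \<in> path_nodes m"
  shows "hyperplane_sign m k (path_mult m x y) =
    sign_mult (hyperplane_sign m k x) (hyperplane_sign m k y)"
proof (cases x)
  case (Edge i)
  then have i: "i < 2 * m" using x by (auto simp: path_nodes_def)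
  have B: "beyond m k (Suc i) = beyond m k i \<longleftrightarrow> i mod m \<noteq> k"
    using beyond_Suc[OF i k] .
  \<comment> \<open>If hyperplane \<open>k\<close> cuts \<open>Edge i\<close>, then
    \<open>near_end\<close> picks the end on the side of \<open>Vertex a\<close>. If not, both ends
    of \<open>Edge i\<close> lie on the same side of it.\<close>
  have C: "hyperplane_sign m k (path_mult m x (Vertex a)) =
    (if i mod m = k then sign_of (beyond m k a) else sign_of (beyond m k i))" for a
    using B Edge by (auto simp: near_end_def)
  show ?thesis
  proof (cases y)
    case (Vertex a)
    then show ?thesis using C Edge by simp
  next
    case (Edge j)
    then show ?thesis using C[of j] \<open>x = Edge i\<close> by simp
  qed
qed simp

text \<open>All values are left zeroes, so it suffices that a product stays in the piece of its left
  factor, whichever end \<open>near_end\<close> picks.\<close>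

lemma cut_sign_hom:
  assumes "x \<in> path_nodes m - {Edge j}"
  shows "cut_sign j (path_mult m x y) = sign_mult (cut_sign j x) (cut_sign j y)"
  using assms by (induction m x y rule: path_mult.induct) (auto simp: near_end_def)

text \<open>Hyperplanes separate distinct points of the cube, and the one cutting an edge separates
  it from all vertices and from all edges not parallel to it. Only the two ends of the path need the
  cut.\<close>

lemma path_signs_separate:
  assumes m: "m \<ge> 2" and j: "j < 2 * m" and xy: "x \<noteq> y"
    and x: "x \<in> path_nodes m - {Edge j}" and y: "y \<in> path_nodes m - {Edge j}"
  shows "(\<exists>k<m. hyperplane_sign m k x \<noteq> hyperplane_sign m k y) \<or> cut_sign j x \<noteq> cut_sign j y"
proof -
  have VV: "(\<exists>k<m. beyond m k a \<noteq> beyond m k b) \<or> (a \<le> j) \<noteq> (b \<le> j)"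
    if ab: "a < b" "b \<le> 2 * m" for a b
  proof -
    \<comment> \<open>Only \<open>0\<close> and \<open>2 * m\<close> are the same point of the cube.
      In the other cases the witness is a hyperplane cutting an edge next to one of the two
      vertices, such that exactly one of its two edges lies between them.\<close>
    consider "a = 0" "b = 2 * m" | "a < m" "b \<le> a + m" | "m \<le> a"
      | "0 < a" "a < m" "a + m < b" | "a = 0" "m < b" "b < 2 * m"
      using ab by linarith
    then show ?thesis
    proof cases
      case 1 then show ?thesis using j by auto
    next
      case 2 then show ?thesis using ab by (intro disjI1 exI[of _ a]) (auto simp: beyond_def)
    next
      case 3 then show ?thesis
        using ab m by (intro disjI1 exI[of _ "a - m"]) (auto simp: beyond_def)
    next
      case 4 then show ?thesis
        using ab by (intro disjI1 exI[of _ "a - 1"]) (auto simp: beyond_def)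
    next
      case 5 then show ?thesis
        using ab by (intro disjI1 exI[of _ "b - m"]) (auto simp: beyond_def)
    qed
  qed
  \<comment> \<open>Parallel edges start at antipodal points, which every hyperplane separates.
    Hyperplane \<open>i\<close> sends both edges to \<open>Zero\<close>, so another one is taken; it
    exists as \<open>m \<ge> 2\<close>.\<close>
  have EE: "\<exists>k<m. k \<noteq> i \<and> beyond m k i \<noteq> beyond m k (i + m)" if "i < m" for i
    using that m by (intro exI[of _ "if i = 0 then 1 else 0"]) (auto simp: beyond_def)
  define sep where "sep u v \<longleftrightarrow> (\<exists>k<m. hyperplane_sign m k u \<noteq> hyperplane_sign m k v) \<or>
    cut_sign j u \<noteq> cut_sign j v" for u v
  have sym: "sep u v \<longleftrightarrow> sep v u" for u v
    unfolding sep_def by metis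
  have VV': "sep (Vertex a) (Vertex b)" if "a < b" "b \<le> 2 * m" for a b
    using VV[OF that] by (simp add: sep_def)
  have EE': "sep (Edge i) (Edge i')" if "i < i'" "i' < 2 * m" for i i'
  proof (cases "i mod m = i' mod m")
    case True
    then have i: "i < m" "i' = i + m"
      using that mod_eq_if_less_double[of i m] mod_eq_if_less_double[of i' m]
      by (auto split: if_splits)
    then obtain k where "k < m" "k \<noteq> i" "beyond m k i \<noteq> beyond m k (i + m)"
      using EE by blast
    with i show ?thesis unfolding sep_def by (intro disjI1 exI[of _ k]) simp
  next
    case False
    have "i mod m < m" using m by simp
    with False show ?thesis unfolding sep_def by (intro disjI1 exI[of _ "i mod m"]) simp
  qed
  have EV: "sep (Edge i) (Vertex a)" for i a
    unfolding sep_def using m by (intro disjI1 exI[of _ "i mod m"]) simp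
  have "sep x y"
  proof (cases x; cases y)
    fix a b assume "x = Vertex a" "y = Vertex b"
    then have "a < b \<or> b < a" "a \<le> 2 * m" "b \<le> 2 * m"
      using x y xy unfolding path_nodes_def by auto
    then show ?thesis
      unfolding \<open>x = Vertex a\<close> \<open>y = Vertex b\<close> using VV' sym by metis
  next
    fix i b assume "x = Edge i" "y = Vertex b"
    then show ?thesis using EV by simp
  next
    fix a i assume "x = Vertex a" "y = Edge i"
    then show ?thesis using EV sym by metis
  next
    fix i i' assume "x = Edge i" "y = Edge i'"
    then have "i < i' \<or> i' < i" "i < 2 * m" "i' < 2 * m"
      using x y xy unfolding path_nodes_def by auto
    then show ?thesis
      unfolding \<open>x = Edge i\<close> \<open>y = Edge i'\<close> using EE' sym by metis
  qed
  then show ?thesis by (simp add: sep_def)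
qed

text \<open>
  Homomorphisms into a semigroup that separate points force associativity, so it need not be
  checked by hand.
\<close>

lemma semigrp_if_separated:
  assumes "carrier T \<noteq> {}" and cl: "\<And>x y. x \<in> carrier T \<Longrightarrow> y \<in> carrier T \<Longrightarrow> x \<cdot>\<^bsub>T\<^esub> y \<in> carrier T"
    and S: "semigrp S"
    and sep: "\<And>x y. x \<in> carrier T \<Longrightarrow> y \<in> carrier T \<Longrightarrow> x \<noteq> y \<Longrightarrow> \<exists>h\<in>sg_hom T S. h x \<noteq> h y"
  shows "semigrp T"
proof
  fix x y z assume xyz: "x \<in> carrier T" "y \<in> carrier T" "z \<in> carrier T"
  have "h (x \<cdot>\<^bsub>T\<^esub> y \<cdot>\<^bsub>T\<^esub> z) = h (x \<cdot>\<^bsub>T\<^esub> (y \<cdot>\<^bsub>T\<^esub> z))" if "h \<in> sg_hom T S" for h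
  proof -
    have "h x \<in> carrier S" "h y \<in> carrier S" "h z \<in> carrier S"
      using that xyz by (auto simp: sg_hom_def)
    then show ?thesis
      using that xyz cl semigrp.assoc[OF S] by (simp add: sg_hom_def)
  qed
  then show "x \<cdot>\<^bsub>T\<^esub> y \<cdot>\<^bsub>T\<^esub> z = x \<cdot>\<^bsub>T\<^esub> (y \<cdot>\<^bsub>T\<^esub> z)"
    using sep cl xyz by meson
qed (use assms in auto)

lemma punctured_path_in_qv_L:
  assumes m: "m \<ge> 2" and j: "j < 2 * m"
  shows "path_sgrp m {j} \<in> qv L"
proof -
  let ?T = "path_sgrp m {j}"
  have sep: "\<exists>h\<in>sg_hom ?T L. h x \<noteq> h y"
    if "x \<in> carrier ?T" "y \<in> carrier ?T" "x \<noteq> y" for x y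
  proof -
    have "hyperplane_sign m k \<in> sg_hom ?T L" if "k < m" for k
      using hyperplane_sign_hom[OF that] by (auto simp: sg_hom_L_iff)
    moreover have "cut_sign j \<in> sg_hom ?T L"
      using cut_sign_hom by (auto simp: sg_hom_L_iff)
    ultimately show ?thesis
      using path_signs_separate[OF m j that(3)] that(1,2) by auto
  qed
  have "Vertex 0 \<in> carrier ?T" by (auto simp: path_nodes_def)
  then have "semigrp ?T"
    by (intro semigrp_if_separated[OF _ _ semigrp_L] sep)
      (use path_mult_closed[of _ m "{j}"] in auto)
  with sep show ?thesis unfolding qv_iff_separates by blast
qed

text \<open>There are \<open>2 * m\<close> edges, too many to fit into \<open>X\<close>.\<close>

lemma few_nodes_miss_an_edge:
  assumes "finite X" "card X < 2 * m" "X \<subseteq> path_nodes m"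
  obtains j where "j < 2 * m" "X \<subseteq> carrier (path_sgrp m {j})"
proof -
  have "\<not> Edge ` {..<2 * m} \<subseteq> X"
    using assms card_mono[of X "Edge ` {..<2 * m}"] by (auto simp: card_image inj_on_def)
  with assms(3) that show ?thesis by auto
qed

text \<open>Associativity concerns three elements at a time. As there are at least four edges, these
  lie in a punctured path, which is associative because homomorphisms separate its points.\<close>

lemma semigrp_path:
  assumes m: "m \<ge> 2"
  shows "semigrp (path_sgrp m {})"
proof
  show "carrier (path_sgrp m {}) \<noteq> {}" by (auto simp: path_nodes_def)
next
  fix x y z assume xyz: "x \<in> carrier (path_sgrp m {})" "y \<in> carrier (path_sgrp m {})"
    "z \<in> carrier (path_sgrp m {})"
  have "card {x, y, z} \<le> 3" by (auto simp: card_insert_if)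
  then obtain j where j: "j < 2 * m" "{x, y, z} \<subseteq> carrier (path_sgrp m {j})"
    using few_nodes_miss_an_edge[of "{x, y, z}" m] m xyz by auto
  then have "semigrp (path_sgrp m {j})"
    using punctured_path_in_qv_L[OF m] by (auto simp: qv_iff_separates)
  from semigrp.assoc[OF this, of x y z] j(2)
  show "x \<cdot>\<^bsub>path_sgrp m {}\<^esub> y \<cdot>\<^bsub>path_sgrp m {}\<^esub> z = x \<cdot>\<^bsub>path_sgrp m {}\<^esub> (y \<cdot>\<^bsub>path_sgrp m {}\<^esub> z)"
    by simp
qed (use path_mult_closed[of _ m "{}"] in auto)

text \<open>
  If some edge is mapped to the identity then its action identifies the images of the two ends
  of the path; otherwise each edge identifies the images of its own ends.
\<close>

lemma path_not_in_qv_ZL: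
  assumes m: "m \<ge> 2"
  shows "path_sgrp m {} \<notin> qv ZL"
proof
  assume qv: "path_sgrp m {} \<in> qv ZL"
  have V: "Vertex a \<in> path_nodes m" if "a \<le> 2 * m" for a
    using that by (auto simp: path_nodes_def)
  have E: "Edge i \<in> path_nodes m" if "i < 2 * m" for i
    using that by (auto simp: path_nodes_def)
  have "\<exists>h\<in>sg_hom (path_sgrp m {}) ZL. h (Vertex 0) \<noteq> h (Vertex (2 * m))"
    using qv V[of 0] V[of "2 * m"] m unfolding qv_iff_separates
    by (auto simp del: mult_path)
  then obtain h where ne: "h (Vertex 0) \<noteq> h (Vertex (2 * m))"
    and h: "\<And>x y. x \<in> path_nodes m \<Longrightarrow> y \<in> path_nodes m \<Longrightarrow>
      h (path_mult m x y) = option_mult sign_mult (h x) (h y)"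
    by (auto simp: sg_hom_ZL_iff)
  have VV: "h (Vertex a) = option_mult sign_mult (h (Vertex a)) (h (Vertex b))"
    if "a \<le> 2 * m" "b \<le> 2 * m" for a b
    using h[OF V[OF that(1)] V[OF that(2)]] by simp
  \<comment> \<open>Vertices are left zeroes, so one vertex sent to \<open>None\<close> drags both
    ends of the path along.\<close>
  have not_None: "h (Vertex a) \<noteq> None" if "a \<le> 2 * m" for a
    using ne VV[of 0 a] VV[of "2 * m" a] that
    by (cases "h (Vertex 0)"; cases "h (Vertex (2 * m))"; cases "h (Vertex a)") auto
  have EV: "h (Vertex i) = h (Vertex (Suc i))" if i: "i < 2 * m" for i
  proof -
    have *: "i mod m < m" using m by simp
    have "h (Vertex i) = option_mult sign_mult (h (Edge i)) (h (Vertex i))"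
      using h[OF E[OF i] V[of i]] i by (simp add: near_end_def)
    moreover have "h (Vertex (Suc i)) = option_mult sign_mult (h (Edge i)) (h (Vertex (Suc i)))"
      using h[OF E[OF i] V[of "Suc i"]] i beyond_Suc[OF i *] by (simp add: near_end_def)
    \<comment> \<open>The two ends of the path are the same point of the cube, hence on the same
      side of every hyperplane.\<close>
    moreover have "\<not> beyond m (i mod m) 0" "\<not> beyond m (i mod m) (2 * m)"
      using * by (auto simp: beyond_def)
    then have "path_mult m (Edge i) (Vertex 0) = path_mult m (Edge i) (Vertex (2 * m))"
      by (simp add: near_end_def)
    then have "option_mult sign_mult (h (Edge i)) (h (Vertex 0)) =
      option_mult sign_mult (h (Edge i)) (h (Vertex (2 * m)))"
      using h[OF E[OF i] V[of 0]] h[OF E[OF i] V[of "2 * m"]] by simp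
    then have "h (Edge i) \<noteq> Some Zero"
      using ne VV[of 0 "2 * m"] VV[of "2 * m" 0]
      by (cases "h (Vertex 0)"; cases "h (Vertex (2 * m))") auto
    \<comment> \<open>Since \<open>Edge i\<close> fixes its ends and these are not sent to
      \<open>None\<close>, neither is \<open>Edge i\<close>. So its image is a left zero, whose
      products with the images of both ends agree.\<close>
    ultimately show ?thesis
      using not_None[of i] not_None[of "Suc i"] i
      by (cases "h (Edge i)"; cases "h (Vertex i)"; cases "h (Vertex (Suc i))";
          cases "the (h (Edge i))") auto
  qed
  have "h (Vertex a) = h (Vertex 0)" if "a \<le> 2 * m" for a
    using that
  proof (induction a)
    case (Suc a)
    then show ?case using EV[of a] by simp
  qed simp
  from this[of "2 * m"] ne show False by simp
qed

lemma node_injection: "\<exists>f :: node \<Rightarrow> 'a::infinite. inj f"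
proof -
  obtain g :: "nat \<Rightarrow> 'a" where g: "inj g"
    using infinite_countable_subset[OF infinite_UNIV] by blast
  have "inj (case_node (\<lambda>a. g (2 * a)) (\<lambda>i. g (2 * i + 1)))"
  proof (rule injI)
    fix u v assume "case_node (\<lambda>a. g (2 * a)) (\<lambda>i. g (2 * i + 1)) u =
      case_node (\<lambda>a. g (2 * a)) (\<lambda>i. g (2 * i + 1)) v"
    then show "u = v"
      by (cases u; cases v) (simp_all add: inj_eq[OF g], presburger+)
  qed
  then show ?thesis by blast
qed

text \<open>This settles both classes at once: the full paths avoid even the larger one, and the
  punctured paths lie even in the smaller one.\<close>

lemma not_finitely_based_between:
  fixes K :: "'a::infinite sgrp set"
  assumes "qv L \<subseteq> K" "K \<subseteq> qv ZL"
  shows "\<not> finitely_based K"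
proof (rule not_finitely_based_if_local)
  fix n :: nat
  \<comment> \<open>This gives both \<open>2 \<le> m\<close> and \<open>n < 2 * m\<close>.\<close>
  define m where "m = n + 2"
  obtain f :: "node \<Rightarrow> 'a" where f: "inj f" using node_injection by blast
  let ?T = "sgrp_image f (path_sgrp m {})"
  have T: "semigrp (path_sgrp m {})" by (rule semigrp_path) (simp add: m_def)
  have "?T \<notin> qv ZL"
    using path_not_in_qv_ZL[of m] sgrp_image_in_qv_iff[OF f T, of ZL] m_def by simp
  moreover have "\<exists>U\<in>K. subsemigroup U ?T \<and> X \<subseteq> carrier U"
    if X: "X \<subseteq> carrier ?T" "finite X" "card X \<le> n" for X
  proof -
    have "X \<subseteq> f ` path_nodes m" using X by simp
    then obtain Y where Y: "Y \<subseteq> path_nodes m" "X = f ` Y" by (auto simp: subset_image_iff)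
    then have "finite Y" "card Y = card X"
      using X f by (auto simp: card_image inj_on_subset[OF f] dest: finite_imageD)
    then obtain j where j: "j < 2 * m" "Y \<subseteq> carrier (path_sgrp m {j})"
      using few_nodes_miss_an_edge[of Y m] X Y by (auto simp: m_def)
    have U: "path_sgrp m {j} \<in> qv L"
      by (rule punctured_path_in_qv_L) (use j in \<open>auto simp: m_def\<close>)
    then have U': "semigrp (path_sgrp m {j})" by (simp add: qv_iff_separates)
    then have "subsemigroup (path_sgrp m {j}) (path_sgrp m {})"
      by (auto simp: subsemigroup_def)
    then have "subsemigroup (sgrp_image f (path_sgrp m {j})) ?T"
      by (rule subsemigroup_sgrp_image[OF f])
    moreover have "sgrp_image f (path_sgrp m {j}) \<in> K"
      using U sgrp_image_in_qv_iff[OF f U', of L] assms by auto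
    ultimately show ?thesis using Y j(2) by (intro bexI conjI) auto
  qed
  ultimately show "\<exists>T. semigrp T \<and> T \<notin> K \<and>
    (\<forall>X\<subseteq>carrier T. finite X \<longrightarrow> card X \<le> n \<longrightarrow> (\<exists>U\<in>K. subsemigroup U T \<and> X \<subseteq> carrier U))"
    using semigrp_sgrp_image[OF f T] assms by blast
qed

subsection \<open>A criterion for finite semigroups\<close>

definition left_regular_band :: "'a sgrp \<Rightarrow> bool" where
  "left_regular_band T \<longleftrightarrow> (\<forall>x\<in>carrier T. \<forall>y\<in>carrier T.
     x \<cdot>\<^bsub>T\<^esub> x = x \<and> x \<cdot>\<^bsub>T\<^esub> y \<cdot>\<^bsub>T\<^esub> x = x \<cdot>\<^bsub>T\<^esub> y)"

text \<open>In a left regular band, the least filter that contains \<open>e\<close>.\<close>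

definition right_stabilizer :: "'a sgrp \<Rightarrow> 'a \<Rightarrow> 'a set" where
  "right_stabilizer T e = {t \<in> carrier T. e \<cdot>\<^bsub>T\<^esub> t = e}"

definition filter_of :: "'a sgrp \<Rightarrow> 'a set \<Rightarrow> bool" where
  "filter_of T F \<longleftrightarrow> F \<subseteq> carrier T \<and>
     (\<forall>s\<in>carrier T. \<forall>t\<in>carrier T. s \<cdot>\<^bsub>T\<^esub> t \<in> F \<longleftrightarrow> s \<in> F \<and> t \<in> F)"

text \<open>
  With \<open>Z\<close> the preimage of the identity, these are the constraints that a homomorphism to \<open>L\<close>
  defined on the filter \<open>F\<close> has to satisfy.
\<close>

definition consistent :: "'a sgrp \<Rightarrow> 'a set \<Rightarrow> 'a set \<Rightarrow> ('a \<Rightarrow> 'b) \<Rightarrow> bool" where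
  "consistent T F Z f \<longleftrightarrow> (\<forall>s\<in>carrier T. \<forall>t\<in>carrier T.
     s \<cdot>\<^bsub>T\<^esub> t \<in> F \<longrightarrow> f (s \<cdot>\<^bsub>T\<^esub> t) = f (if s \<in> Z then t else s))"

text \<open>Elements of \<open>Z\<close> all go to the identity. If \<open>Z\<close> is a filter
  containing exactly one of \<open>x\<close> and \<open>y\<close>, then membership in
  \<open>Z\<close> is a consistent \<open>f\<close>, so demanding \<open>f x \<noteq> f y\<close>
  loses nothing.\<close>

definition splits :: "'a sgrp \<Rightarrow> 'a set \<Rightarrow> 'a set \<Rightarrow> 'a \<Rightarrow> 'a \<Rightarrow> bool" where
  "splits T F Z x y \<longleftrightarrow> \<not> (x \<in> Z \<and> y \<in> Z) \<and> (\<exists>f :: 'a \<Rightarrow> bool. consistent T F Z f \<and> f x \<noteq> f y)"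

text \<open>Merging all colours other than that of \<open>x\<close> leaves two. This serves for
  \<open>sign\<close>-valued homomorphisms and for the colours computed by the program
  alike.\<close>

lemma splitsI:
  assumes "consistent T F Z f" "f x \<noteq> f y" "\<not> (x \<in> Z \<and> y \<in> Z)"
  shows "splits T F Z x y"
  unfolding splits_def
proof (intro conjI exI)
  show "consistent T F Z (\<lambda>t. f t = f x)"
    using assms(1) unfolding consistent_def by metis
qed (use assms in auto)

text \<open>If \<open>e \<cdot> s \<cdot> t = e\<close>, then appending \<open>s\<close> or
  \<open>t\<close> to both sides changes nothing on the left, by
  \<open>s \<cdot> t \<cdot> s = s \<cdot> t\<close> and \<open>t \<cdot> t = t\<close>.\<close>

lemma filter_of_right_stabilizer:
  assumes T: "semigrp T" "left_regular_band T" and e: "e \<in> carrier T"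
  shows "filter_of T (right_stabilizer T e)"
  unfolding filter_of_def
proof (intro conjI ballI)
  interpret semigrp T by (fact T)
  fix s t assume st: "s \<in> carrier T" "t \<in> carrier T"
  have band: "x \<cdot>\<^bsub>T\<^esub> x = x" "x \<cdot>\<^bsub>T\<^esub> y \<cdot>\<^bsub>T\<^esub> x = x \<cdot>\<^bsub>T\<^esub> y"
    if "x \<in> carrier T" "y \<in> carrier T" for x y
    using T(2) that by (auto simp: left_regular_band_def)
  have "e \<cdot>\<^bsub>T\<^esub> s = e \<and> e \<cdot>\<^bsub>T\<^esub> t = e" if *: "e \<cdot>\<^bsub>T\<^esub> (s \<cdot>\<^bsub>T\<^esub> t) = e"
  proof
    have "e \<cdot>\<^bsub>T\<^esub> s = e \<cdot>\<^bsub>T\<^esub> (s \<cdot>\<^bsub>T\<^esub> t \<cdot>\<^bsub>T\<^esub> s)"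
      using * e st by (metis assoc closed)
    then show "e \<cdot>\<^bsub>T\<^esub> s = e" using * band st by simp
    have "e \<cdot>\<^bsub>T\<^esub> t = e \<cdot>\<^bsub>T\<^esub> (s \<cdot>\<^bsub>T\<^esub> (t \<cdot>\<^bsub>T\<^esub> t))"
      using * e st by (metis assoc closed)
    then show "e \<cdot>\<^bsub>T\<^esub> t = e" using * band st by simp
  qed
  moreover have "e \<cdot>\<^bsub>T\<^esub> (s \<cdot>\<^bsub>T\<^esub> t) = e" if "e \<cdot>\<^bsub>T\<^esub> s = e" "e \<cdot>\<^bsub>T\<^esub> t = e"
    using that e st assoc by metis
  ultimately show "s \<cdot>\<^bsub>T\<^esub> t \<in> right_stabilizer T e \<longleftrightarrow>
      s \<in> right_stabilizer T e \<and> t \<in> right_stabilizer T e"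
    using st closed by (auto simp: right_stabilizer_def)
qed (auto simp: right_stabilizer_def)

text \<open>The witness is the product of all elements of the filter.\<close>

lemma filter_of_finite:
  assumes T: "semigrp T" "left_regular_band T" "finite (carrier T)"
    and F: "filter_of T F" "F \<noteq> {}"
  shows "\<exists>e\<in>F. F = right_stabilizer T e"
proof -
  interpret semigrp T by (fact T)
  have mem: "s \<cdot>\<^bsub>T\<^esub> t \<in> F \<longleftrightarrow> s \<in> F \<and> t \<in> F"
    if "s \<in> carrier T" "t \<in> carrier T" for s t
    using F(1) that unfolding filter_of_def by blast
  have sub: "F \<subseteq> carrier T" using F by (auto simp: filter_of_def)
  have band: "x \<cdot>\<^bsub>T\<^esub> x = x" "x \<cdot>\<^bsub>T\<^esub> y \<cdot>\<^bsub>T\<^esub> x = x \<cdot>\<^bsub>T\<^esub> y"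
    if "x \<in> carrier T" "y \<in> carrier T" for x y
    using T(2) that by (auto simp: left_regular_band_def)
  have "\<exists>e\<in>F. \<forall>t\<in>A. e \<cdot>\<^bsub>T\<^esub> t = e" if "finite A" "A \<subseteq> F" for A
    using that
  proof (induction A)
    case empty
    then show ?case using F by auto
  next
    case (insert a A)
    then obtain e where e: "e \<in> F" "\<forall>t\<in>A. e \<cdot>\<^bsub>T\<^esub> t = e" by auto
    have a: "a \<in> carrier T" "e \<in> carrier T" using insert e sub by auto
    have "e \<cdot>\<^bsub>T\<^esub> a \<cdot>\<^bsub>T\<^esub> t = e \<cdot>\<^bsub>T\<^esub> a" if "t \<in> A" for t
    proof -
      have t: "t \<in> carrier T" "e \<cdot>\<^bsub>T\<^esub> t = e" using that insert e sub by auto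
      \<comment> \<open>As \<open>e\<close> absorbs \<open>t\<close>, a factor \<open>t\<close> may
        be inserted before \<open>a\<close>; left regularity then removes the one after
        \<open>a\<close>.\<close>
      then have "e \<cdot>\<^bsub>T\<^esub> a \<cdot>\<^bsub>T\<^esub> t = e \<cdot>\<^bsub>T\<^esub> (t \<cdot>\<^bsub>T\<^esub> a \<cdot>\<^bsub>T\<^esub> t)"
        using a by (metis assoc closed)
      also have "\<dots> = e \<cdot>\<^bsub>T\<^esub> a" using t a band by (metis assoc)
      finally show ?thesis .
    qed
    moreover have "e \<cdot>\<^bsub>T\<^esub> a \<cdot>\<^bsub>T\<^esub> a = e \<cdot>\<^bsub>T\<^esub> a" using a band assoc by simp
    moreover have "e \<cdot>\<^bsub>T\<^esub> a \<in> F" using mem a e insert by auto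
    ultimately show ?case by auto
  qed
  from this[OF finite_subset[OF sub T(3)] subset_refl]
  obtain e where e: "e \<in> F" "\<forall>t\<in>F. e \<cdot>\<^bsub>T\<^esub> t = e" by blast
  have "t \<in> F" if "t \<in> carrier T" "e \<cdot>\<^bsub>T\<^esub> t = e" for t
    using mem[of e t] that e(1) sub by auto
  with e sub have "F = right_stabilizer T e"
    unfolding right_stabilizer_def by blast
  with e show ?thesis by blast
qed

lemma filter_of_carrier: "semigrp T \<Longrightarrow> filter_of T (carrier T)"
  using semigrp.closed by (fastforce simp: filter_of_def)

lemma filter_of_empty: "filter_of T {}"
  by (simp add: filter_of_def)

lemma left_regular_band_if_separated:
  assumes T: "semigrp T" and S: "left_regular_band S"
    and sep: "\<And>x y. x \<in> carrier T \<Longrightarrow> y \<in> carrier T \<Longrightarrow> x \<noteq> y \<Longrightarrow> \<exists>h\<in>sg_hom T S. h x \<noteq> h y"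
  shows "left_regular_band T"
  unfolding left_regular_band_def
proof (intro ballI)
  interpret semigrp T by (fact T)
  fix x y assume xy: "x \<in> carrier T" "y \<in> carrier T"
  have "h (x \<cdot>\<^bsub>T\<^esub> x) = h x \<and> h (x \<cdot>\<^bsub>T\<^esub> y \<cdot>\<^bsub>T\<^esub> x) = h (x \<cdot>\<^bsub>T\<^esub> y)" if "h \<in> sg_hom T S" for h
  proof -
    have "h x \<in> carrier S" "h y \<in> carrier S" using that xy by (auto simp: sg_hom_def)
    then show ?thesis using that xy closed S by (simp add: sg_hom_def left_regular_band_def)
  qed
  then show "x \<cdot>\<^bsub>T\<^esub> x = x \<and> x \<cdot>\<^bsub>T\<^esub> y \<cdot>\<^bsub>T\<^esub> x = x \<cdot>\<^bsub>T\<^esub> y"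
    using sep xy closed by metis
qed

lemma left_regular_band_L: "left_regular_band L"
proof -
  have "sign_mult x x = x \<and> sign_mult (sign_mult x y) x = sign_mult x y" for x y
    by (cases x; cases y) auto
  then show ?thesis by (simp add: left_regular_band_def)
qed

lemma left_regular_band_ZL: "left_regular_band ZL"
proof -
  have "option_mult sign_mult x x = x \<and>
    option_mult sign_mult (option_mult sign_mult x y) x = option_mult sign_mult x y" for x y
    by (cases x; cases y; cases "the x"; cases "the y") auto
  then show ?thesis by (simp add: left_regular_band_def)
qed

text \<open>The candidates for the preimage of the identity: at most one more than there are
  elements.\<close>

definition principal_filters :: "'a sgrp \<Rightarrow> 'a set set" where
  "principal_filters T = insert {} (right_stabilizer T ` carrier T)"

lemma principal_filters_iff:
  assumes "semigrp T" "left_regular_band T" "finite (carrier T)"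
  shows "Z \<in> principal_filters T \<longleftrightarrow> filter_of T Z"
proof
  show "Z \<in> principal_filters T \<Longrightarrow> filter_of T Z"
    using filter_of_right_stabilizer[OF assms(1,2)] filter_of_empty
    by (auto simp: principal_filters_def)
  assume Z: "filter_of T Z"
  show "Z \<in> principal_filters T"
  proof (cases "Z = {}")
    case False
    from filter_of_finite[OF assms Z this] Z show ?thesis
      by (auto simp: principal_filters_def filter_of_def)
  qed (simp add: principal_filters_def)
qed

text \<open>Send \<open>Z\<close> to the identity and let \<open>f\<close> choose the sign
  elsewhere; consistency is needed only for products in \<open>F\<close>.\<close>

lemma hom_L_if_splits:
  assumes F: "filter_of T F" and Z: "filter_of T Z" and sp: "splits T F Z x y"
  obtains h where "h x \<noteq> h y" "\<And>s t. s \<in> F \<Longrightarrow> t \<in> F \<Longrightarrow> h (s \<cdot>\<^bsub>T\<^esub> t) = sign_mult (h s) (h t)"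
proof -
  obtain f :: "'a \<Rightarrow> bool" where f: "consistent T F Z f" "f x \<noteq> f y" and xy: "\<not> (x \<in> Z \<and> y \<in> Z)"
    using sp by (auto simp: splits_def)
  define h where "h t = (if t \<in> Z then Zero else sign_of (f t))" for t
  show ?thesis
  proof
    show "h x \<noteq> h y" using f xy by (auto simp: h_def)
    fix s t assume st: "s \<in> F" "t \<in> F"
    then have c: "s \<in> carrier T" "t \<in> carrier T" using F by (auto simp: filter_of_def)
    then have "s \<cdot>\<^bsub>T\<^esub> t \<in> F" using F st by (auto simp: filter_of_def)
    then have "f (s \<cdot>\<^bsub>T\<^esub> t) = f (if s \<in> Z then t else s)"
      using f c by (auto simp: consistent_def)
    moreover have "s \<cdot>\<^bsub>T\<^esub> t \<in> Z \<longleftrightarrow> s \<in> Z \<and> t \<in> Z" using Z c by (auto simp: filter_of_def)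
    ultimately show "h (s \<cdot>\<^bsub>T\<^esub> t) = sign_mult (h s) (h t)" by (auto simp: h_def)
  qed
qed

text \<open>A homomorphism to \<open>L\<close> amounts to the filter sent to the identity and a
  consistent colouring; the homomorphism itself serves as the colouring.\<close>

lemma qv_L_iff:
  assumes T: "semigrp T" and fin: "finite (carrier T)"
  shows "T \<in> qv L \<longleftrightarrow> left_regular_band T \<and>
    (\<forall>x\<in>carrier T. \<forall>y\<in>carrier T. x \<noteq> y \<longrightarrow>
      (\<exists>Z\<in>principal_filters T. splits T (carrier T) Z x y))"
proof (intro iffI conjI ballI impI)
  assume qv: "T \<in> qv L"
  then show lrb: "left_regular_band T"
    using left_regular_band_if_separated[OF T left_regular_band_L] by (auto simp: qv_iff_separates)
  fix x y assume xy: "x \<in> carrier T" "y \<in> carrier T" "x \<noteq> y"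
  then obtain h where h: "h \<in> sg_hom T L" "h x \<noteq> h y" using qv by (auto simp: qv_iff_separates)
  define Z where "Z = {t \<in> carrier T. h t = Zero}"
  have sm: "sign_mult a b = Zero \<longleftrightarrow> a = Zero \<and> b = Zero" for a b by (cases a) auto
  have "filter_of T Z"
    using h semigrp.closed[OF T] by (auto simp: filter_of_def Z_def sg_hom_L_iff sm)
  moreover have "splits T (carrier T) Z x y"
  proof (rule splitsI)
    have "sign_mult a b = (if a = Zero then b else a)" for a b by (cases a) auto
    then show "consistent T (carrier T) Z h"
      using h by (auto simp: consistent_def Z_def sg_hom_L_iff)
  qed (use h in \<open>auto simp: Z_def\<close>)
  ultimately show "\<exists>Z\<in>principal_filters T. splits T (carrier T) Z x y"
    using principal_filters_iff[OF T lrb fin] by auto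
next
  assume R: "left_regular_band T \<and> (\<forall>x\<in>carrier T. \<forall>y\<in>carrier T. x \<noteq> y \<longrightarrow>
      (\<exists>Z\<in>principal_filters T. splits T (carrier T) Z x y))"
  show "T \<in> qv L"
    unfolding qv_iff_separates
  proof (intro conjI T ballI impI)
    fix x y assume xy: "x \<in> carrier T" "y \<in> carrier T" "x \<noteq> y"
    then obtain Z where Z: "filter_of T Z" "splits T (carrier T) Z x y"
      using R principal_filters_iff[OF T _ fin] by blast
    from hom_L_if_splits[OF filter_of_carrier[OF T] this]
    obtain h where "h x \<noteq> h y"
      "\<And>s t. s \<in> carrier T \<Longrightarrow> t \<in> carrier T \<Longrightarrow> h (s \<cdot>\<^bsub>T\<^esub> t) = sign_mult (h s) (h t)"
      by blast
    moreover from this have "h \<in> sg_hom T L" by (simp add: sg_hom_L_iff)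
    ultimately show "\<exists>h\<in>sg_hom T L. h x \<noteq> h y" by blast
  qed
qed

text \<open>
  A homomorphism to \<open>ZL\<close> is a homomorphism to \<open>L\<close> defined on a filter; if it separates \<open>x\<close> from
  another element of that filter, then it can be restricted to the least filter containing \<open>x\<close>.
\<close>

lemma qv_ZL_iff:
  assumes T: "semigrp T" and fin: "finite (carrier T)"
  shows "T \<in> qv ZL \<longleftrightarrow> left_regular_band T \<and>
    (\<forall>x\<in>carrier T. \<forall>y\<in>carrier T. x \<noteq> y \<longrightarrow>
      (\<exists>Z\<in>principal_filters T. splits T (right_stabilizer T x) Z x y))"
proof (intro iffI conjI ballI impI)
  assume qv: "T \<in> qv ZL"
  then show lrb: "left_regular_band T"
    using left_regular_band_if_separated[OF T left_regular_band_ZL] by (auto simp: qv_iff_separates)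
  fix x y assume xy: "x \<in> carrier T" "y \<in> carrier T" "x \<noteq> y"
  then obtain h where h: "h \<in> sg_hom T ZL" "h x \<noteq> h y" using qv by (auto simp: qv_iff_separates)
  define G where "G = {t \<in> carrier T. \<exists>c. h t = Some c}"
  define Z where "Z = {t \<in> carrier T. h t = Some Zero}"
  have om: "(\<exists>c. option_mult sign_mult a b = Some c) \<longleftrightarrow> (\<exists>c. a = Some c) \<and> (\<exists>c. b = Some c)"
    "option_mult sign_mult a b = Some Zero \<longleftrightarrow> a = Some Zero \<and> b = Some Zero" for a b
    by (cases a; cases b; cases "the a"; auto)+
  have G: "filter_of T G"
    using h semigrp.closed[OF T] om(1) by (auto simp: filter_of_def G_def sg_hom_ZL_iff)
  have Z: "filter_of T Z"
    using h semigrp.closed[OF T] om(2) by (auto simp: filter_of_def Z_def sg_hom_ZL_iff)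
  show "\<exists>Z\<in>principal_filters T. splits T (right_stabilizer T x) Z x y"
  proof (cases "x \<in> G \<and> y \<in> G")
    case True
    have "splits T (right_stabilizer T x) Z x y"
    proof (rule splitsI)
      have "option_mult sign_mult a b = (if a = Some Zero then b else a)" if "b \<noteq> None" for a b
        using that by (cases a; cases b; cases "the a") auto
      \<comment> \<open>The formula above excludes \<open>b = None\<close>. Here
        \<open>x = x \<cdot> (s \<cdot> t)\<close> lies in the filter \<open>G\<close>, which forces
        \<open>t\<close> into it.\<close>
      moreover have "t \<in> G" if "s \<in> carrier T" "t \<in> carrier T" "x \<cdot>\<^bsub>T\<^esub> (s \<cdot>\<^bsub>T\<^esub> t) = x" for s t
      proof -
        have st: "s \<cdot>\<^bsub>T\<^esub> t \<in> carrier T" using that semigrp.closed[OF T] by blast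
        have "x \<cdot>\<^bsub>T\<^esub> (s \<cdot>\<^bsub>T\<^esub> t) \<in> G" unfolding that(3) using True by blast
        then show ?thesis using G that(1,2) xy(1) st unfolding filter_of_def by blast
      qed
      ultimately show "consistent T (right_stabilizer T x) Z h"
        using h by (auto simp: consistent_def Z_def G_def right_stabilizer_def sg_hom_ZL_iff)
    qed (use h in \<open>auto simp: Z_def\<close>)
    with Z show ?thesis using principal_filters_iff[OF T lrb fin] by auto
  next
    case False
    \<comment> \<open>Exactly one of \<open>x\<close> and \<open>y\<close> lies in \<open>G\<close>,
      since \<open>h\<close> sends all else to \<open>None\<close>. So \<open>G\<close> itself can
      play the part of \<open>Z\<close>.\<close>
    have "splits T (right_stabilizer T x) G x y"
    proof (rule splitsI)
      show "consistent T (right_stabilizer T x) G (\<lambda>t. t \<in> G)"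
        using G by (auto simp: consistent_def filter_of_def)
    qed (use False h xy in \<open>auto simp: G_def\<close>)
    with G show ?thesis using principal_filters_iff[OF T lrb fin] by auto
  qed
next
  assume R: "left_regular_band T \<and> (\<forall>x\<in>carrier T. \<forall>y\<in>carrier T. x \<noteq> y \<longrightarrow>
      (\<exists>Z\<in>principal_filters T. splits T (right_stabilizer T x) Z x y))"
  then have lrb: "left_regular_band T" by simp
  show "T \<in> qv ZL"
    unfolding qv_iff_separates
  proof (intro conjI T ballI impI)
    fix x y assume xy: "x \<in> carrier T" "y \<in> carrier T" "x \<noteq> y"
    then obtain Z where Z: "filter_of T Z" "splits T (right_stabilizer T x) Z x y"
      using R principal_filters_iff[OF T lrb fin] by blast
    define F where "F = right_stabilizer T x"
    have F: "filter_of T F"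
      unfolding F_def by (rule filter_of_right_stabilizer[OF T lrb xy(1)])
    have "x \<in> F" using lrb xy by (auto simp: F_def right_stabilizer_def left_regular_band_def)
    from hom_L_if_splits[OF F Z[folded F_def]]
    obtain h where h: "h x \<noteq> h y"
      "\<And>s t. s \<in> F \<Longrightarrow> t \<in> F \<Longrightarrow> h (s \<cdot>\<^bsub>T\<^esub> t) = sign_mult (h s) (h t)"
      by blast
    \<comment> \<open>If \<open>y\<close> lies outside \<open>F\<close>, the zero separates it from
      \<open>x\<close>.\<close>
    define k where "k t = (if t \<in> F then Some (h t) else None)" for t
    have "k \<in> sg_hom T ZL"
      using h F by (auto simp: sg_hom_ZL_iff k_def filter_of_def)
    moreover have "k x \<noteq> k y" using h(1) \<open>x \<in> F\<close> by (simp add: k_def)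
    ultimately show "\<exists>h\<in>sg_hom T ZL. h x \<noteq> h y" by blast
  qed
qed

subsection \<open>Reasoning about programs\<close>

text \<open>Total correctness with a time bound; the inequality allows rounding up in each
  rule.\<close>

definition run :: "nat \<Rightarrow> program \<Rightarrow> memory \<Rightarrow> (memory \<Rightarrow> bool) \<Rightarrow> bool" where
  "run k c s Q \<longleftrightarrow> (\<exists>t s'. exec c s t s' \<and> t \<le> k \<and> Q s')"

lemma run_mono:
  "run k c s P \<Longrightarrow> (\<And>s'. P s' \<Longrightarrow> Q s') \<Longrightarrow> k \<le> k' \<Longrightarrow> run k' c s Q"
  unfolding run_def by (meson le_trans)

lemma run_Skip: "Q s \<Longrightarrow> run 1 Skip s Q"
  unfolding run_def using exec.Skip by blast

lemma run_Store: "Q (s(expr_val d s := expr_val e s)) \<Longrightarrow> run 1 (Store d e) s Q"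
  unfolding run_def using exec.Store by blast

lemma run_Seq:
  "run k c s P \<Longrightarrow> (\<And>s'. P s' \<Longrightarrow> run k' c' s' Q) \<Longrightarrow> run (k + k') (Seq c c') s Q"
  unfolding run_def using exec.Seq by (meson add_mono)

lemma run_Store_Seq:
  "run k c (s(expr_val d s := expr_val e s)) Q \<Longrightarrow> run (1 + k) (Seq (Store d e) c) s Q"
  by (rule run_Seq[of 1 _ s "\<lambda>s'. s' = s(expr_val d s := expr_val e s)"], rule run_Store) simp_all

text \<open>Adding the costs of the branches instead of taking their maximum keeps all bounds
  polynomial expressions.\<close>

lemma run_Cond:
  assumes "expr_val e s \<noteq> 0 \<Longrightarrow> run k c s Q" "expr_val e s = 0 \<Longrightarrow> run k' c' s Q"
  shows "run (k + k' + 1) (Cond e c c') s Q"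
proof (cases "expr_val e s = 0")
  case True
  with assms(2) obtain t s' where "exec c' s t s'" "t \<le> k'" "Q s'" by (auto simp: run_def)
  with exec.Cond_False[OF _ this(1)] True show ?thesis
    unfolding run_def by (intro exI[of _ "t + 1"] exI[of _ s']) simp
next
  case False
  with assms(1) obtain t s' where "exec c s t s'" "t \<le> k" "Q s'" by (auto simp: run_def)
  with exec.Cond_True[OF _ this(1)] False show ?thesis
    unfolding run_def by (intro exI[of _ "t + 1"] exI[of _ s']) simp
qed

text \<open>The index of \<open>I\<close> counts the iterations still to come.\<close>

lemma run_While:
  assumes step: "\<And>j s. I (Suc j) s \<Longrightarrow> expr_val b s \<noteq> 0 \<and> run k c s (I j)"
    and stop: "\<And>s. I 0 s \<Longrightarrow> expr_val b s = 0"
  shows "I N s \<Longrightarrow> run (N * (k + 1) + 1) (While b c) s (I 0)"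
proof (induction N arbitrary: s)
  case 0
  then show ?case
    unfolding run_def using exec.While_False[OF stop] by force
next
  case (Suc N)
  from step[OF Suc.prems] obtain t s' where
    1: "expr_val b s \<noteq> 0" "exec c s t s'" "t \<le> k" "I N s'" by (auto simp: run_def)
  from Suc.IH[OF this(4)] obtain u r where
    2: "exec (While b c) s' u r" "u \<le> N * (k + 1) + 1" "I 0 r" by (auto simp: run_def)
  have "exec (While b c) s (t + u + 1) r" using 1 2 by (intro exec.While_True)
  moreover have "t + u + 1 \<le> Suc N * (k + 1) + 1" using 1 2 by simp
  ultimately show ?case using 2 unfolding run_def by blast
qed

abbreviation reg :: "nat \<Rightarrow> expr" where
  "reg r \<equiv> Cell (Const r)"

text \<open>The bound \<open>e\<close> is evaluated anew in each test; truncated subtraction makes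
  the test succeed exactly while register \<open>r\<close> is below it.\<close>

definition for_loop :: "nat \<Rightarrow> expr \<Rightarrow> program \<Rightarrow> program" where
  "for_loop r e c = Seq (Store (Const r) (Const 0))
     (While (Sub e (reg r)) (Seq c (Store (Const r) (Add (reg r) (Const 1)))))"

lemma run_for_loop:
  assumes init: "I 0 (s(r := 0))"
    and step: "\<And>j s. j < N \<Longrightarrow> I j s \<Longrightarrow> s r = j \<Longrightarrow>
      run k c s (\<lambda>s'. s' r = j \<and> I (Suc j) (s'(r := Suc j)))"
    and bound: "\<And>j s. I j s \<Longrightarrow> expr_val e s = N"
  shows "run (N * (k + 2) + 2) (for_loop r e c) s (I N)"
proof -
  \<comment> \<open>\<open>I\<close> counts completed iterations, whereas \<open>run_While\<close>
    counts remaining ones.\<close>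
  define J where "J i s \<longleftrightarrow> i \<le> N \<and> s r = N - i \<and> I (N - i) s" for i s
  have "run (N * ((k + 1) + 1) + 1)
      (While (Sub e (reg r)) (Seq c (Store (Const r) (Add (reg r) (Const 1))))) (s(r := 0)) (J 0)"
  proof (rule run_While)
    fix i s assume J: "J (Suc i) s"
    let ?j = "N - Suc i"
    have "run k c s (\<lambda>s'. s' r = ?j \<and> I (Suc ?j) (s'(r := Suc ?j)))"
      using J by (intro step) (auto simp: J_def)
    then have "run (k + 1) (Seq c (Store (Const r) (Add (reg r) (Const 1)))) s (J i)"
    proof (rule run_Seq)
      have "Suc ?j = N - i" using J by (auto simp: J_def)
      then show "run 1 (Store (Const r) (Add (reg r) (Const 1))) s' (J i)"
        if "s' r = ?j \<and> I (Suc ?j) (s'(r := Suc ?j))" for s'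
        using that J by (intro run_Store) (simp add: J_def)
    qed
    then show "expr_val (Sub e (reg r)) s \<noteq> 0 \<and>
        run (k + 1) (Seq c (Store (Const r) (Add (reg r) (Const 1)))) s (J i)"
      using J bound[of ?j s] by (auto simp: J_def)
  next
    show "J N (s(r := 0))" unfolding J_def using init by simp
  qed (use bound in \<open>auto simp: J_def\<close>)
  then have "run (1 + (N * ((k + 1) + 1) + 1)) (for_loop r e c) s (J 0)"
    unfolding for_loop_def by (intro run_Store_Seq) simp
  then show ?thesis by (rule run_mono) (auto simp: J_def)
qed

subsection \<open>Expressions and memory layout\<close>

text \<open>
  After loading, cell \<open>0\<close> contains the order \<open>n\<close>, cells \<open>1\<close> to \<open>10\<close> are used as registers, cell
  \<open>11 + 2i\<close> contains the address of row \<open>i\<close> of the multiplication table, cell \<open>12 + 2i\<close> contains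
  the colour of the element \<open>i\<close>, and the table starts at cell \<open>12 + 2n\<close>.
\<close>

definition loaded :: "nat \<Rightarrow> nat sgrp \<Rightarrow> memory \<Rightarrow> bool" where
  "loaded n T s \<longleftrightarrow> s 0 = n \<and> (\<forall>i<n. s (11 + 2 * i) = 12 + 2 * n + i * n) \<and>
     (\<forall>i<n. \<forall>j<n. s (12 + 2 * n + i * n + j) = i \<cdot>\<^bsub>T\<^esub> j)"

definition colours :: "memory \<Rightarrow> nat \<Rightarrow> nat" where
  "colours s i = s (12 + 2 * i)"

text \<open>Only registers from \<open>m\<close> on and colours have changed.\<close>

definition frame :: "nat \<Rightarrow> nat \<Rightarrow> memory \<Rightarrow> memory \<Rightarrow> bool" where
  "frame n m s s' \<longleftrightarrow> (\<forall>a. a < m \<or> 11 \<le> a \<and> (odd a \<or> 12 + 2 * n \<le> a) \<longrightarrow> s' a = s a)"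

lemma frame_refl [simp]: "frame n m s s"
  by (simp add: frame_def)

lemma frame_trans: "frame n m s s' \<Longrightarrow> frame n m' s' s'' \<Longrightarrow> m \<le> m' \<Longrightarrow> frame n m s s''"
  by (auto simp: frame_def)

lemma frame_mono: "frame n m' s s' \<Longrightarrow> m \<le> m' \<Longrightarrow> frame n m s s'"
  by (auto simp: frame_def)

lemma frame_reg: "frame n m s s' \<Longrightarrow> r < m \<Longrightarrow> s' r = s r"
  by (simp add: frame_def)

lemma frame_upd_reg: "frame n m s s' \<Longrightarrow> m \<le> r \<Longrightarrow> r < 11 \<Longrightarrow> frame n m s (s'(r := v))"
  by (auto simp: frame_def)

lemma frame_upd_colour:
  "frame n m s s' \<Longrightarrow> m \<le> 11 \<Longrightarrow> i < n \<Longrightarrow> frame n m s (s'(12 + 2 * i := v))"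
  by (auto simp: frame_def)

lemma loaded_frame: "loaded n T s \<Longrightarrow> frame n m s s' \<Longrightarrow> 1 \<le> m \<Longrightarrow> loaded n T s'"
  by (auto simp: frame_def loaded_def)

lemma loaded_upd_reg [simp]: "1 \<le> r \<Longrightarrow> r < 11 \<Longrightarrow> loaded n T (s(r := v)) = loaded n T s"
  by (auto simp: loaded_def)

lemma colours_upd_reg [simp]: "r < 11 \<Longrightarrow> colours (s(r := v)) = colours s"
  by (auto simp: colours_def)

lemma colours_upd_colour [simp]: "colours (s(12 + 2 * i := v)) = (colours s)(i := v)"
  by (auto simp: colours_def)

definition differ :: "expr \<Rightarrow> expr \<Rightarrow> expr" where
  "differ a b = Add (Sub a b) (Sub b a)"

text \<open>The machine cannot multiply, so the address of row \<open>a\<close> is looked up in cell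
  \<open>11 + 2 * a\<close>.\<close>

definition product :: "expr \<Rightarrow> expr \<Rightarrow> expr" where
  "product a b = Cell (Add (Cell (Add (Const 11) (Add a a))) b)"

definition colour_addr :: "expr \<Rightarrow> expr" where
  "colour_addr a = Add (Const 12) (Add a a)"

definition colour :: "expr \<Rightarrow> expr" where
  "colour a = Cell (colour_addr a)"

text \<open>Register 5 numbers the filter. From the value \<open>n\<close> on it stands for the
  empty filter: then the second summand is \<open>1\<close>, whatever the lookup in a missing row
  gives.\<close>

definition outside :: "expr \<Rightarrow> expr" where
  "outside a = Add (differ (product (reg 5) a) (reg 5)) (Sub (Const 1) (Sub (reg 0) (reg 5)))"

lemma expr_val_differ [simp]: "expr_val (differ a b) s = 0 \<longleftrightarrow> expr_val a s = expr_val b s"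
  by (auto simp: differ_def)

lemma expr_val_product [simp]:
  "loaded n T s \<Longrightarrow> expr_val a s < n \<Longrightarrow> expr_val b s < n \<Longrightarrow>
    expr_val (product a b) s = expr_val a s \<cdot>\<^bsub>T\<^esub> expr_val b s"
  by (simp add: product_def loaded_def flip: mult_2)

lemma expr_val_colour_addr [simp]: "expr_val (colour_addr a) s = 12 + 2 * expr_val a s"
  by (simp add: colour_addr_def)

lemma expr_val_colour [simp]: "expr_val (colour a) s = colours s (expr_val a s)"
  by (simp add: colour_def colours_def)

definition stabilizer_below :: "nat \<Rightarrow> nat sgrp \<Rightarrow> nat \<Rightarrow> nat set" where
  "stabilizer_below n T e = (if e < n then right_stabilizer T e else {})"

lemma principal_filters_eq:
  "carrier T = {..<n} \<Longrightarrow> principal_filters T = stabilizer_below n T ` {..n}"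
  by (auto simp: principal_filters_def stabilizer_below_def image_iff)

lemma expr_val_outside [simp]:
  "loaded n T s \<Longrightarrow> carrier T = {..<n} \<Longrightarrow> expr_val a s < n \<Longrightarrow>
    expr_val (outside a) s = 0 \<longleftrightarrow> expr_val a s \<in> stabilizer_below n T (s 5)"
  using expr_val_product[of n T s "reg 5" a]
  by (cases "s 5 < n")
    (auto simp: outside_def stabilizer_below_def right_stabilizer_def loaded_def simp del: expr_val_product)

subsection \<open>The decision procedure\<close>

text \<open>One step of computing connected components by relabelling: the class of the factor that
  determines the colour is renamed to the colour of the product. Registers 8 and 9 save both
  colours, as the loop overwrites colour cells.\<close>

definition merge_program :: "expr \<Rightarrow> program" where
  "merge_program g = Cond g
     (Seq (Store (Const 8) (colour (product (reg 6) (reg 7))))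
     (Seq (Cond (outside (reg 6)) (Store (Const 9) (colour (reg 6))) (Store (Const 9) (colour (reg 7))))
       (for_loop 10 (reg 0)
         (Cond (differ (colour (reg 10)) (reg 9)) Skip (Store (colour_addr (reg 10)) (reg 8))))))
     Skip"

text \<open>A single pass over the pairs suffices, since merging never separates elements of equal
  colour.\<close>

definition colour_program :: "expr \<Rightarrow> program" where
  "colour_program g = Seq
     (for_loop 6 (reg 0) (Store (colour_addr (reg 6)) (reg 6)))
     (for_loop 6 (reg 0) (for_loop 7 (reg 0) (merge_program g)))"

text \<open>The bound \<open>n + 1\<close> lets register 5 reach \<open>n\<close>, the number of the
  empty filter.\<close>

definition split_program :: "expr \<Rightarrow> program" where
  "split_program g = Seq (Store (Const 4) (Const 0))
     (for_loop 5 (Add (reg 0) (Const 1)) (Seq (colour_program g)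
       (Cond (differ (colour (reg 2)) (colour (reg 3)))
         (Cond (Add (outside (reg 2)) (outside (reg 3))) (Store (Const 4) (Const 1)) Skip) Skip)))"

definition all_pairs :: "program \<Rightarrow> program" where
  "all_pairs c = for_loop 2 (reg 0) (for_loop 3 (reg 0) c)"

definition band_test :: program where
  "band_test = Cond (Add (differ (product (reg 2) (reg 2)) (reg 2))
     (differ (product (product (reg 2) (reg 3)) (reg 2)) (product (reg 2) (reg 3))))
     (Store (Const 1) (Const 0)) Skip"

definition split_test :: "expr \<Rightarrow> program" where
  "split_test g = Cond (differ (reg 2) (reg 3))
     (Seq (split_program g) (Cond (reg 4) Skip (Store (Const 1) (Const 0)))) Skip"

text \<open>The loops read their bound from cell 0, so the verdict is collected in register 1 and
  moved there only at the end.\<close>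

definition criterion_program :: "expr \<Rightarrow> program" where
  "criterion_program g = Seq (Store (Const 1) (Const 1)) (Seq (all_pairs band_test)
     (Seq (all_pairs (split_test g)) (Store (Const 0) (reg 1))))"

text \<open>The type is left open: over \<open>nat\<close> this is a bound for \<open>run\<close>,
  and over polynomials it helps to build the bound that \<open>poly_time_decidable\<close> asks
  for.\<close>

definition pairs_time :: "'a::comm_semiring_1 \<Rightarrow> 'a \<Rightarrow> 'a" where
  "pairs_time n k = n * ((n * (k + 2) + 2) + 2) + 2"

definition merge_time :: "'a::comm_semiring_1 \<Rightarrow> 'a" where
  "merge_time n = 1 + (3 + (n * (3 + 2) + 2)) + 1 + 1"

definition colour_time :: "'a::comm_semiring_1 \<Rightarrow> 'a" where
  "colour_time n = (n * (1 + 2) + 2) + pairs_time n (merge_time n)"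

definition split_time :: "'a::comm_semiring_1 \<Rightarrow> 'a" where
  "split_time n = 1 + ((n + 1) * (colour_time n + 5 + 2) + 2)"

definition criterion_time :: "'a::comm_semiring_1 \<Rightarrow> 'a" where
  "criterion_time n = 1 + (pairs_time n 3 + (pairs_time n (split_time n + 3 + 1 + 1) + 1))"

section \<open>Correctness and running time\<close>

text \<open>One program scheme for both classes: \<open>F x\<close> will be the whole carrier for
  \<open>L\<close> and the stabilizer of \<open>x\<close> for \<open>ZL\<close>, with
  \<open>g\<close> as the matching membership test.\<close>

locale table_program =
  fixes n :: nat and T :: "nat sgrp" and F :: "nat \<Rightarrow> nat set" and g :: expr
  assumes semigrp: "semigrp T" and carrier_eq: "carrier T = {..<n}"
    and guard: "\<And>s. loaded n T s \<Longrightarrow> s 2 < n \<Longrightarrow> s 6 < n \<Longrightarrow> s 7 < n \<Longrightarrow>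
      expr_val g s = 0 \<longleftrightarrow> s 6 \<cdot>\<^bsub>T\<^esub> s 7 \<notin> F (s 2)"
begin

abbreviation stab :: "nat \<Rightarrow> nat set" where
  "stab \<equiv> stabilizer_below n T"

lemma closed: "i < n \<Longrightarrow> j < n \<Longrightarrow> i \<cdot>\<^bsub>T\<^esub> j < n"
  using semigrp.closed[OF semigrp] carrier_eq by auto

lemmas outside_iff [simp] = expr_val_outside[OF _ carrier_eq]

definition merged :: "nat \<Rightarrow> nat \<Rightarrow> nat \<Rightarrow> nat \<Rightarrow> (nat \<Rightarrow> nat) \<Rightarrow> nat \<Rightarrow> nat" where
  "merged x e i j c v = (if i \<cdot>\<^bsub>T\<^esub> j \<in> F x \<and> c v = c (if i \<in> stab e then j else i)
     then c (i \<cdot>\<^bsub>T\<^esub> j) else c v)"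

lemma run_merge_program:
  assumes s: "loaded n T s" "s 2 = x" "s 5 = e" "s 6 = i" "s 7 = j" "x < n" "i < n" "j < n"
  shows "run (merge_time n) (merge_program g) s
    (\<lambda>s'. frame n 8 s s' \<and> (\<forall>v<n. colours s' v = merged x e i j (colours s) v))"
proof -
  let ?c = "colours s"
  let ?r = "if i \<in> stab e then j else i"
  let ?s1 = "s(8 := ?c (i \<cdot>\<^bsub>T\<^esub> j))"
  let ?s2 = "?s1(9 := ?c ?r)"
  let ?loop = "for_loop 10 (reg 0)
    (Cond (differ (colour (reg 10)) (reg 9)) Skip (Store (colour_addr (reg 10)) (reg 8)))"
  define I where "I w s' \<longleftrightarrow> frame n 10 ?s2 s' \<and>
    (\<forall>v<n. colours s' v = (if v < w \<and> ?c v = ?c ?r then ?c (i \<cdot>\<^bsub>T\<^esub> j) else ?c v))" for w s'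
  have loop: "run (n * (3 + 2) + 2) ?loop ?s2 (I n)"
  proof (rule run_for_loop)
    show "I 0 (?s2(10 := 0))" by (auto simp: I_def intro: frame_upd_reg)
  next
    fix w s' assume I: "w < n" "I w s'" "s' 10 = w"
    then have regs: "s' 9 = ?c ?r" "s' 8 = ?c (i \<cdot>\<^bsub>T\<^esub> j)" "colours s' w = ?c w"
      by (auto simp: I_def frame_reg)
    have "run (1 + 1 + 1)
      (Cond (differ (colour (reg 10)) (reg 9)) Skip (Store (colour_addr (reg 10)) (reg 8))) s'
      (\<lambda>s''. s'' 10 = w \<and> I (Suc w) (s''(10 := Suc w)))"
    proof (intro run_Cond run_Skip run_Store)
      assume "expr_val (differ (colour (reg 10)) (reg 9)) s' \<noteq> 0"
      then have "?c w \<noteq> ?c ?r" using I regs by simp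
      then show "s' 10 = w \<and> I (Suc w) (s'(10 := Suc w))"
        using I unfolding I_def by (auto simp: less_Suc_eq intro: frame_upd_reg)
    next
      assume "expr_val (differ (colour (reg 10)) (reg 9)) s' = 0"
      then have "?c w = ?c ?r" using I regs by simp
      moreover have "expr_val (colour_addr (reg 10)) s' = 12 + 2 * w" "expr_val (reg 8) s' = ?c (i \<cdot>\<^bsub>T\<^esub> j)"
        using I regs by simp_all
      ultimately show "(s'(expr_val (colour_addr (reg 10)) s' := expr_val (reg 8) s')) 10 = w \<and>
        I (Suc w) (s'(expr_val (colour_addr (reg 10)) s' := expr_val (reg 8) s', 10 := Suc w))"
        using I unfolding I_def
        by (auto simp: less_Suc_eq intro!: frame_upd_reg frame_upd_colour)
    qed
    then show "run 3 (Cond (differ (colour (reg 10)) (reg 9)) Skip (Store (colour_addr (reg 10)) (reg 8))) s'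
      (\<lambda>s''. s'' 10 = w \<and> I (Suc w) (s''(10 := Suc w)))"
      by (rule run_mono) simp_all
  next
    fix w s' assume "I w s'"
    then show "expr_val (reg 0) s' = n"
      using s by (auto simp: I_def frame_reg loaded_def)
  qed
  have g: "expr_val g s = 0 \<longleftrightarrow> i \<cdot>\<^bsub>T\<^esub> j \<notin> F x"
    using guard[of s] s by simp
  have "run (1 + (3 + (n * (3 + 2) + 2)) + 1 + 1) (merge_program g) s
    (\<lambda>s'. frame n 8 s s' \<and> (\<forall>v<n. colours s' v = merged x e i j ?c v))"
    unfolding merge_program_def
  proof (intro run_Cond run_Skip run_Store_Seq)
    assume "expr_val g s \<noteq> 0"
    then have F: "i \<cdot>\<^bsub>T\<^esub> j \<in> F x" using g by simp
    have s1: "s(expr_val (Const 8) s := expr_val (colour (product (reg 6) (reg 7))) s) = ?s1"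
      using s by simp
    show "run (3 + (n * (3 + 2) + 2)) (Seq (Cond (outside (reg 6)) (Store (Const 9) (colour (reg 6)))
        (Store (Const 9) (colour (reg 7)))) ?loop)
      (s(expr_val (Const 8) s := expr_val (colour (product (reg 6) (reg 7))) s))
      (\<lambda>s'. frame n 8 s s' \<and> (\<forall>v<n. colours s' v = merged x e i j ?c v))"
      unfolding s1
    proof (rule run_Seq)
      have "run (1 + 1 + 1) (Cond (outside (reg 6)) (Store (Const 9) (colour (reg 6)))
        (Store (Const 9) (colour (reg 7)))) ?s1 (\<lambda>s'. s' = ?s2)"
        using s by (intro run_Cond run_Store) auto
      then show "run 3 (Cond (outside (reg 6)) (Store (Const 9) (colour (reg 6)))
        (Store (Const 9) (colour (reg 7)))) ?s1 (\<lambda>s'. s' = ?s2)"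
        by (rule run_mono) simp_all
    next
      fix s' assume "s' = ?s2"
      then show "run (n * (3 + 2) + 2) ?loop s'
        (\<lambda>s'. frame n 8 s s' \<and> (\<forall>v<n. colours s' v = merged x e i j ?c v))"
      proof (simp only:, intro run_mono[OF loop] conjI)
        fix s' assume I: "I n s'"
        have "frame n 8 ?s2 s'" using I by (auto simp: I_def intro: frame_mono)
        moreover have "frame n 8 s ?s2" by (intro frame_upd_reg) auto
        ultimately show "frame n 8 s s'" by (auto elim: frame_trans)
        show "\<forall>v<n. colours s' v = merged x e i j ?c v"
          using I F by (simp add: I_def merged_def)
      qed simp
    qed
  qed (use g in \<open>auto simp: merged_def\<close>)
  then show ?thesis by (simp add: merge_time_def)
qed

text \<open>The loop invariant: \<open>c\<close> obeys the constraints from \<open>P\<close>, and it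
  is no coarser than any consistent two-colouring.\<close>

definition coloured :: "nat \<Rightarrow> nat \<Rightarrow> (nat \<times> nat) set \<Rightarrow> (nat \<Rightarrow> nat) \<Rightarrow> bool" where
  "coloured x e P c \<longleftrightarrow>
    (\<forall>i j. (i, j) \<in> P \<longrightarrow> i \<cdot>\<^bsub>T\<^esub> j \<in> F x \<longrightarrow> c (i \<cdot>\<^bsub>T\<^esub> j) = c (if i \<in> stab e then j else i)) \<and>
    (\<forall>f :: nat \<Rightarrow> bool. consistent T (F x) (stab e) f \<longrightarrow>
      (\<forall>u<n. \<forall>v<n. c u = c v \<longrightarrow> f u = f v))"

text \<open>Merging preserves equalities of colours, so old constraints survive. The two classes
  merged have the same \<open>f\<close>-value for every consistent \<open>f\<close>, so
  \<open>c'\<close> does not become too coarse.\<close>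

lemma coloured_merged:
  assumes c: "coloured x e P c" and P: "P \<subseteq> {..<n} \<times> {..<n}" and ij: "i < n" "j < n"
    and c': "\<forall>v<n. c' v = merged x e i j c v"
  shows "coloured x e (insert (i, j) P) c'"
proof (cases "i \<cdot>\<^bsub>T\<^esub> j \<in> F x")
  case True
  let ?r = "if i \<in> stab e then j else i"
  have p: "i \<cdot>\<^bsub>T\<^esub> j < n" "?r < n" using closed ij by auto
  have c'_eq: "c' v = (if c v = c ?r then c (i \<cdot>\<^bsub>T\<^esub> j) else c v)" if "v < n" for v
    using c' that True by (simp add: merged_def)
  show ?thesis
    unfolding coloured_def
  proof (intro conjI allI impI)
    fix a b assume ab: "(a, b) \<in> insert (i, j) P" "a \<cdot>\<^bsub>T\<^esub> b \<in> F x"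
    then have "a < n" "b < n" using P ij by auto
    then have "a \<cdot>\<^bsub>T\<^esub> b < n" "(if a \<in> stab e then b else a) < n" using closed by auto
    moreover have "(a, b) = (i, j) \<or> c (a \<cdot>\<^bsub>T\<^esub> b) = c (if a \<in> stab e then b else a)"
      using ab c by (auto simp: coloured_def)
    ultimately show "c' (a \<cdot>\<^bsub>T\<^esub> b) = c' (if a \<in> stab e then b else a)"
      unfolding c'_eq[OF \<open>a \<cdot>\<^bsub>T\<^esub> b < n\<close>] c'_eq[OF \<open>(if a \<in> stab e then b else a) < n\<close>] by auto
  next
    fix f :: "nat \<Rightarrow> bool" and u v
    assume f: "consistent T (F x) (stab e) f" and uv: "u < n" "v < n" "c' u = c' v"
    have f1: "f a = f b" if "a < n" "b < n" "c a = c b" for a b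
      using c f that by (auto simp: coloured_def)
    have f2: "f (i \<cdot>\<^bsub>T\<^esub> j) = f ?r"
      using f True ij carrier_eq by (auto simp: consistent_def)
    show "f u = f v"
      using uv(3) f1[OF uv(1,2)] f1[OF uv(1) p(1)] f1[OF uv(1) p(2)] f1[OF uv(2) p(1)]
        f1[OF uv(2) p(2)] f2
      unfolding c'_eq[OF uv(1)] c'_eq[OF uv(2)] by (auto split: if_splits)
  qed
next
  case False
  then have eq: "c' v = c v" if "v < n" for v using c' that by (simp add: merged_def)
  show ?thesis
    unfolding coloured_def
  proof (intro conjI allI impI)
    fix a b assume ab: "(a, b) \<in> insert (i, j) P" "a \<cdot>\<^bsub>T\<^esub> b \<in> F x"
    then have P': "(a, b) \<in> P" using False by auto
    then have "a < n" "b < n" using P by auto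
    then have "c' (a \<cdot>\<^bsub>T\<^esub> b) = c (a \<cdot>\<^bsub>T\<^esub> b)"
      "c' (if a \<in> stab e then b else a) = c (if a \<in> stab e then b else a)"
      using closed eq by auto
    then show "c' (a \<cdot>\<^bsub>T\<^esub> b) = c' (if a \<in> stab e then b else a)"
      using c P' ab by (simp add: coloured_def)
  qed (use c eq in \<open>auto simp: coloured_def\<close>)
qed

text \<open>After all pairs \<open>c\<close> is itself consistent, and it is the finest such
  colouring, so it separates whatever can be separated.\<close>

lemma splits_iff_coloured:
  assumes c: "coloured x e ({..<n} \<times> {..<n}) c" and uv: "u < n" "v < n"
  shows "splits T (F x) (stab e) u v \<longleftrightarrow> \<not> (u \<in> stab e \<and> v \<in> stab e) \<and> c u \<noteq> c v"
proof
  assume "splits T (F x) (stab e) u v"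
  with c uv show "\<not> (u \<in> stab e \<and> v \<in> stab e) \<and> c u \<noteq> c v"
    unfolding splits_def coloured_def by metis
next
  have "consistent T (F x) (stab e) c"
    using c carrier_eq by (auto simp: consistent_def coloured_def)
  then show "splits T (F x) (stab e) u v" if "\<not> (u \<in> stab e \<and> v \<in> stab e) \<and> c u \<noteq> c v"
    using that by (intro splitsI) auto
qed

lemma run_colour_program:
  assumes s: "loaded n T s" "s 2 = x" "s 5 = e" "x < n"
  shows "run (colour_time n) (colour_program g) s
    (\<lambda>s'. frame n 6 s s' \<and> coloured x e ({..<n} \<times> {..<n}) (colours s'))"
proof -
  define I where "I i s' \<longleftrightarrow> frame n 6 s s' \<and> (\<forall>v<i. colours s' v = v)" for i s'
  define K where "K P s' \<longleftrightarrow> frame n 6 s s' \<and> coloured x e P (colours s')" for P s'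
  have upd: "K P (s'(r := v)) \<longleftrightarrow> K P s'" if "6 \<le> r" "r < 11" for P s' r v
    using that by (auto simp: K_def frame_def)
  have size: "expr_val (reg 0) s' = n" if "frame n 6 s s'" for s'
    using that s by (auto simp: frame_def loaded_def)
  have 1: "run (n * (1 + 2) + 2) (for_loop 6 (reg 0) (Store (colour_addr (reg 6)) (reg 6))) s (I n)"
  proof (rule run_for_loop)
    show "I 0 (s(6 := 0))" by (auto simp: I_def intro: frame_upd_reg)
  next
    fix i s' assume I: "i < n" "I i s'" "s' 6 = i"
    show "run 1 (Store (colour_addr (reg 6)) (reg 6)) s' (\<lambda>s'. s' 6 = i \<and> I (Suc i) (s'(6 := Suc i)))"
    proof (rule run_Store)
      have "expr_val (colour_addr (reg 6)) s' = 12 + 2 * i" "expr_val (reg 6) s' = i"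
        using I by simp_all
      then show "(s'(expr_val (colour_addr (reg 6)) s' := expr_val (reg 6) s')) 6 = i \<and>
        I (Suc i) (s'(expr_val (colour_addr (reg 6)) s' := expr_val (reg 6) s', 6 := Suc i))"
        using I unfolding I_def by (auto simp: less_Suc_eq intro!: frame_upd_reg frame_upd_colour)
    qed
  qed (use size in \<open>auto simp: I_def\<close>)
  have init: "K {} s'" if "I n s'" for s'
    using that by (auto simp: I_def K_def coloured_def)
  have 2: "run (pairs_time n (merge_time n)) (for_loop 6 (reg 0) (for_loop 7 (reg 0) (merge_program g))) s'
    (K ({..<n} \<times> {..<n}))" if "I n s'" for s'
    unfolding pairs_time_def
  proof (rule run_for_loop[where I = "\<lambda>i. K ({..<i} \<times> {..<n})"])
    show "K ({..<0} \<times> {..<n}) (s'(6 := 0))" using init[OF that] by (simp add: upd)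
  next
    fix i s' assume i: "i < n" "K ({..<i} \<times> {..<n}) s'" "s' 6 = i"
    \<comment> \<open>The pairs that precede \<open>(i, j)\<close> in the order of the two
      loops.\<close>
    let ?P = "\<lambda>j. {..<i} \<times> {..<n} \<union> {i} \<times> {..<j}"
    have "run (n * (merge_time n + 2) + 2) (for_loop 7 (reg 0) (merge_program g)) s'
      (\<lambda>s''. s'' 6 = i \<and> K (?P n) s'')"
    proof (rule run_for_loop[where I = "\<lambda>j s''. s'' 6 = i \<and> K (?P j) s''"])
      show "(s'(7 := 0)) 6 = i \<and> K (?P 0) (s'(7 := 0))" using i by (simp add: upd)
    next
      fix j s'' assume j: "j < n" "s'' 6 = i \<and> K (?P j) s''" "s'' 7 = j"
      then have fr: "frame n 6 s s''" by (simp add: K_def)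
      have "run (merge_time n) (merge_program g) s''
        (\<lambda>r. frame n 8 s'' r \<and> (\<forall>v<n. colours r v = merged x e i j (colours s'') v))"
        using s i j loaded_frame[OF s(1) fr] frame_reg[OF fr, of 2] frame_reg[OF fr, of 5]
        by (intro run_merge_program) auto
      then show "run (merge_time n) (merge_program g) s''
        (\<lambda>r. r 7 = j \<and> (r(7 := Suc j)) 6 = i \<and> K (?P (Suc j)) (r(7 := Suc j)))"
      proof (rule run_mono)
        fix r assume r: "frame n 8 s'' r \<and> (\<forall>v<n. colours r v = merged x e i j (colours s'') v)"
        have "?P j \<subseteq> {..<n} \<times> {..<n}" using i j by auto
        then have "coloured x e (insert (i, j) (?P j)) (colours r)"
          using r i j by (intro coloured_merged[of x e "?P j" "colours s''"]) (auto simp: K_def)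
        moreover have "insert (i, j) (?P j) = ?P (Suc j)" by auto
        moreover have "frame n 6 s r"
          using fr r by (auto elim: frame_trans)
        ultimately have "K (?P (Suc j)) r" by (simp add: K_def)
        moreover have "r 7 = j" "r 6 = i" using r j by (auto simp: frame_reg)
        ultimately show "r 7 = j \<and> (r(7 := Suc j)) 6 = i \<and> K (?P (Suc j)) (r(7 := Suc j))"
          by (simp add: upd)
      qed simp
    qed (use size in \<open>auto simp: K_def\<close>)
    then show "run (n * (merge_time n + 2) + 2) (for_loop 7 (reg 0) (merge_program g)) s'
      (\<lambda>s''. s'' 6 = i \<and> K ({..<Suc i} \<times> {..<n}) (s''(6 := Suc i)))"
    proof (rule run_mono)
      have "?P n = {..<Suc i} \<times> {..<n}" by auto
      then show "r 6 = i \<and> K ({..<Suc i} \<times> {..<n}) (r(6 := Suc i))" if "r 6 = i \<and> K (?P n) r" for r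
        using that by (simp add: upd)
    qed simp
  qed (use size in \<open>auto simp: K_def\<close>)
  show ?thesis
    unfolding colour_program_def colour_time_def
    using run_Seq[OF 1 2] unfolding K_def .
qed

lemma run_split_program:
  assumes s: "loaded n T s" "s 2 = x" "s 3 = y" "x < n" "y < n"
  shows "run (split_time n) (split_program g) s
    (\<lambda>s'. frame n 4 s s' \<and> (s' 4 \<noteq> 0 \<longleftrightarrow> (\<exists>e\<le>n. splits T (F x) (stab e) x y)))"
proof -
  define I where "I e s' \<longleftrightarrow> frame n 4 s s' \<and> (s' 4 \<noteq> 0 \<longleftrightarrow> (\<exists>e'<e. splits T (F x) (stab e') x y))"
    for e s'
  let ?test = "Cond (differ (colour (reg 2)) (colour (reg 3)))
         (Cond (Add (outside (reg 2)) (outside (reg 3))) (Store (Const 4) (Const 1)) Skip) Skip"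
  have "run ((n + 1) * (colour_time n + 5 + 2) + 2)
    (for_loop 5 (Add (reg 0) (Const 1)) (Seq (colour_program g) ?test)) (s(4 := 0)) (I (n + 1))"
  proof (rule run_for_loop)
    show "I 0 (s(4 := 0, 5 := 0))" by (auto simp: I_def intro!: frame_upd_reg)
  next
    fix e s' assume e: "e < n + 1" "I e s'" "s' 5 = e"
    then have fr: "frame n 4 s s'" by (simp add: I_def)
    have s': "loaded n T s'" "s' 2 = x" "s' 3 = y"
      using loaded_frame[OF s(1) fr] s fr by (auto simp: frame_reg)
    show "run (colour_time n + 5) (Seq (colour_program g) ?test) s'
      (\<lambda>r. r 5 = e \<and> I (Suc e) (r(5 := Suc e)))"
    proof (rule run_Seq)
      show "run (colour_time n) (colour_program g) s'
        (\<lambda>r. frame n 6 s' r \<and> coloured x e ({..<n} \<times> {..<n}) (colours r))"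
        using s s' e by (intro run_colour_program) auto
    next
      fix r assume r: "frame n 6 s' r \<and> coloured x e ({..<n} \<times> {..<n}) (colours r)"
      then have r': "loaded n T r" "r 2 = x" "r 3 = y" "r 5 = e" "r 4 = s' 4"
        using s' e loaded_frame[OF s'(1), of 6 r] by (auto simp: frame_reg)
      have frr: "frame n 4 s r"
        using fr r by (auto elim: frame_trans)
      have sp: "splits T (F x) (stab e) x y \<longleftrightarrow>
        \<not> (x \<in> stab e \<and> y \<in> stab e) \<and> colours r x \<noteq> colours r y"
        using r s by (intro splits_iff_coloured) auto
      have step: "(\<exists>e'<Suc e. splits T (F x) (stab e') x y) \<longleftrightarrow>
          s' 4 \<noteq> 0 \<or> splits T (F x) (stab e) x y"
        using e by (auto simp: I_def less_Suc_eq)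
      have "run ((1 + 1 + 1) + 1 + 1) ?test r (\<lambda>r. r 5 = e \<and> I (Suc e) (r(5 := Suc e)))"
      proof (intro run_Cond run_Store run_Skip)
        assume "expr_val (differ (colour (reg 2)) (colour (reg 3))) r \<noteq> 0"
          "expr_val (Add (outside (reg 2)) (outside (reg 3))) r \<noteq> 0"
        then have "splits T (F x) (stab e) x y" using sp r' s by auto
        then show "(r(expr_val (Const 4) r := expr_val (Const 1) r)) 5 = e \<and>
          I (Suc e) (r(expr_val (Const 4) r := expr_val (Const 1) r, 5 := Suc e))"
          using step frr r' unfolding I_def by (auto intro!: frame_upd_reg)
      next
        assume "expr_val (differ (colour (reg 2)) (colour (reg 3))) r \<noteq> 0"
          "expr_val (Add (outside (reg 2)) (outside (reg 3))) r = 0"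
        then have "\<not> splits T (F x) (stab e) x y" using sp r' s by auto
        then show "r 5 = e \<and> I (Suc e) (r(5 := Suc e))"
          using step frr r' unfolding I_def by (auto intro!: frame_upd_reg)
      next
        assume "expr_val (differ (colour (reg 2)) (colour (reg 3))) r = 0"
        then have "\<not> splits T (F x) (stab e) x y" using sp r' s by auto
        then show "r 5 = e \<and> I (Suc e) (r(5 := Suc e))"
          using step frr r' unfolding I_def by (auto intro!: frame_upd_reg)
      qed
      then show "run 5 ?test r (\<lambda>r. r 5 = e \<and> I (Suc e) (r(5 := Suc e)))"
        by (rule run_mono) simp_all
    qed
  next
    fix e s' assume "I e s'"
    then show "expr_val (Add (reg 0) (Const 1)) s' = n + 1"
      using s by (auto simp: I_def frame_reg loaded_def)
  qed
  then have "run (split_time n) (split_program g) s (I (n + 1))"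
    unfolding split_program_def split_time_def by (intro run_Store_Seq) simp
  then show ?thesis by (rule run_mono) (auto simp: I_def less_Suc_eq_le)
qed

text \<open>Register 1 carries the conjunction of the verdicts so far. Comparing with
  \<open>s(1 := s' 1)\<close> exempts just this register from the frame condition.\<close>

lemma run_all_pairs:
  assumes body: "\<And>s x y. loaded n T s \<Longrightarrow> s 2 = x \<Longrightarrow> s 3 = y \<Longrightarrow> x < n \<Longrightarrow> y < n \<Longrightarrow>
      run k c s (\<lambda>s'. frame n 4 (s(1 := s' 1)) s' \<and> (s' 1 \<noteq> 0 \<longleftrightarrow> s 1 \<noteq> 0 \<and> Q x y))"
    and s: "loaded n T s"
  shows "run (pairs_time n k) (all_pairs c) s (\<lambda>s'. loaded n T s' \<and>
    (s' 1 \<noteq> 0 \<longleftrightarrow> s 1 \<noteq> 0 \<and> (\<forall>x<n. \<forall>y<n. Q x y)))"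
proof -
  define I where "I i s' \<longleftrightarrow> loaded n T s' \<and> (s' 1 \<noteq> 0 \<longleftrightarrow> s 1 \<noteq> 0 \<and> (\<forall>x<i. \<forall>y<n. Q x y))" for i s'
  have size: "expr_val (reg 0) s' = n" if "loaded n T s'" for s'
    using that by (simp add: loaded_def)
  have "run (pairs_time n k) (all_pairs c) s (I n)"
    unfolding pairs_time_def all_pairs_def
  proof (rule run_for_loop)
    show "I 0 (s(2 := 0))" using s by (simp add: I_def)
  next
    fix i s' assume i: "i < n" "I i s'" "s' 2 = i"
    define J where "J j r \<longleftrightarrow> loaded n T r \<and> r 2 = i \<and>
      (r 1 \<noteq> 0 \<longleftrightarrow> s' 1 \<noteq> 0 \<and> (\<forall>y<j. Q i y))" for j r
    have "run (n * (k + 2) + 2) (for_loop 3 (reg 0) c) s' (J n)"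
    proof (rule run_for_loop)
      show "J 0 (s'(3 := 0))" using i by (simp add: J_def I_def)
    next
      fix j r assume j: "j < n" "J j r" "r 3 = j"
      then have "run k c r (\<lambda>r'. frame n 4 (r(1 := r' 1)) r' \<and> (r' 1 \<noteq> 0 \<longleftrightarrow> r 1 \<noteq> 0 \<and> Q i j))"
        using i by (intro body) (auto simp: J_def)
      then show "run k c r (\<lambda>r'. r' 3 = j \<and> J (Suc j) (r'(3 := Suc j)))"
      proof (rule run_mono)
        fix r' assume r': "frame n 4 (r(1 := r' 1)) r' \<and> (r' 1 \<noteq> 0 \<longleftrightarrow> r 1 \<noteq> 0 \<and> Q i j)"
        have "loaded n T (r(1 := r' 1))" using j by (simp add: J_def)
        from loaded_frame[OF this, of 4 r'] r' have "loaded n T r'" by simp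
        moreover have "r' 2 = i" "r' 3 = j"
          using r' j frame_reg[of n 4 "r(1 := r' 1)" r' 2] frame_reg[of n 4 "r(1 := r' 1)" r' 3]
          by (auto simp: J_def)
        moreover note r'
        ultimately show "r' 3 = j \<and> J (Suc j) (r'(3 := Suc j))"
          using j by (auto simp: J_def less_Suc_eq)
      qed simp
    qed (use size in \<open>auto simp: J_def\<close>)
    then show "run (n * (k + 2) + 2) (for_loop 3 (reg 0) c) s'
      (\<lambda>r. r 2 = i \<and> I (Suc i) (r(2 := Suc i)))"
      by (rule run_mono) (use i in \<open>auto simp: I_def J_def less_Suc_eq\<close>)
  qed (use size in \<open>auto simp: I_def\<close>)
  then show ?thesis unfolding I_def .
qed

lemma run_band_test:
  assumes s: "loaded n T s" "s 2 = x" "s 3 = y" "x < n" "y < n"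
  shows "run 3 band_test s (\<lambda>s'. frame n 4 (s(1 := s' 1)) s' \<and>
    (s' 1 \<noteq> 0 \<longleftrightarrow> s 1 \<noteq> 0 \<and> x \<cdot>\<^bsub>T\<^esub> x = x \<and> x \<cdot>\<^bsub>T\<^esub> y \<cdot>\<^bsub>T\<^esub> x = x \<cdot>\<^bsub>T\<^esub> y))"
proof -
  have "run (1 + 1 + 1) band_test s (\<lambda>s'. frame n 4 (s(1 := s' 1)) s' \<and>
    (s' 1 \<noteq> 0 \<longleftrightarrow> s 1 \<noteq> 0 \<and> x \<cdot>\<^bsub>T\<^esub> x = x \<and> x \<cdot>\<^bsub>T\<^esub> y \<cdot>\<^bsub>T\<^esub> x = x \<cdot>\<^bsub>T\<^esub> y))"
    unfolding band_test_def
    by (intro run_Cond run_Store run_Skip) (use s closed in auto)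
  then show ?thesis by (rule run_mono) simp_all
qed

lemma run_split_test:
  assumes s: "loaded n T s" "s 2 = x" "s 3 = y" "x < n" "y < n"
  shows "run (split_time n + 3 + 1 + 1) (split_test g) s (\<lambda>s'. frame n 4 (s(1 := s' 1)) s' \<and>
    (s' 1 \<noteq> 0 \<longleftrightarrow> s 1 \<noteq> 0 \<and> (x \<noteq> y \<longrightarrow> (\<exists>e\<le>n. splits T (F x) (stab e) x y))))"
  unfolding split_test_def
proof (rule run_Cond)
  assume "expr_val (differ (reg 2) (reg 3)) s \<noteq> 0"
  then have "x \<noteq> y" using s by auto
  show "run (split_time n + 3) (Seq (split_program g) (Cond (reg 4) Skip (Store (Const 1) (Const 0)))) s
    (\<lambda>s'. frame n 4 (s(1 := s' 1)) s' \<and>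
    (s' 1 \<noteq> 0 \<longleftrightarrow> s 1 \<noteq> 0 \<and> (x \<noteq> y \<longrightarrow> (\<exists>e\<le>n. splits T (F x) (stab e) x y))))"
  proof (rule run_Seq[OF run_split_program[OF s]])
    fix r assume r: "frame n 4 s r \<and> (r 4 \<noteq> 0 \<longleftrightarrow> (\<exists>e\<le>n. splits T (F x) (stab e) x y))"
    then have "r 1 = s 1" by (simp add: frame_def)
    have "run (1 + 1 + 1) (Cond (reg 4) Skip (Store (Const 1) (Const 0))) r
      (\<lambda>s'. frame n 4 (s(1 := s' 1)) s' \<and>
      (s' 1 \<noteq> 0 \<longleftrightarrow> s 1 \<noteq> 0 \<and> (x \<noteq> y \<longrightarrow> (\<exists>e\<le>n. splits T (F x) (stab e) x y))))"
      by (intro run_Cond run_Store run_Skip)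
        (use r \<open>x \<noteq> y\<close> \<open>r 1 = s 1\<close> in \<open>auto simp: frame_def\<close>)
    then show "run 3 (Cond (reg 4) Skip (Store (Const 1) (Const 0))) r
      (\<lambda>s'. frame n 4 (s(1 := s' 1)) s' \<and>
      (s' 1 \<noteq> 0 \<longleftrightarrow> s 1 \<noteq> 0 \<and> (x \<noteq> y \<longrightarrow> (\<exists>e\<le>n. splits T (F x) (stab e) x y))))"
      by (rule run_mono) simp_all
  qed
next
  assume "expr_val (differ (reg 2) (reg 3)) s = 0"
  then show "run 1 Skip s (\<lambda>s'. frame n 4 (s(1 := s' 1)) s' \<and>
    (s' 1 \<noteq> 0 \<longleftrightarrow> s 1 \<noteq> 0 \<and> (x \<noteq> y \<longrightarrow> (\<exists>e\<le>n. splits T (F x) (stab e) x y))))"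
    using s by (intro run_Skip) auto
qed

definition criterion :: bool where
  "criterion \<longleftrightarrow> left_regular_band T \<and>
    (\<forall>x\<in>carrier T. \<forall>y\<in>carrier T. x \<noteq> y \<longrightarrow> (\<exists>Z\<in>principal_filters T. splits T (F x) Z x y))"

lemma run_criterion_program:
  assumes s: "loaded n T s"
  shows "run (criterion_time n) (criterion_program g) s (\<lambda>s'. s' 0 \<noteq> 0 \<longleftrightarrow> criterion)"
proof -
  have "run (1 + (pairs_time n 3 + (pairs_time n (split_time n + 3 + 1 + 1) + 1)))
    (criterion_program g) s (\<lambda>s'. s' 0 \<noteq> 0 \<longleftrightarrow> criterion)"
    unfolding criterion_program_def
  proof (rule run_Store_Seq)
    have s1: "loaded n T (s(expr_val (Const 1) s := expr_val (Const 1) s))" using s by simp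
    show "run (pairs_time n 3 + (pairs_time n (split_time n + 3 + 1 + 1) + 1))
      (Seq (all_pairs band_test) (Seq (all_pairs (split_test g)) (Store (Const 0) (reg 1))))
      (s(expr_val (Const 1) s := expr_val (Const 1) s)) (\<lambda>s'. s' 0 \<noteq> 0 \<longleftrightarrow> criterion)"
    proof (rule run_Seq[OF run_all_pairs[OF run_band_test s1]])
      fix r assume r: "loaded n T r \<and> (r 1 \<noteq> 0 \<longleftrightarrow>
        (s(expr_val (Const 1) s := expr_val (Const 1) s)) 1 \<noteq> 0 \<and>
        (\<forall>x<n. \<forall>y<n. x \<cdot>\<^bsub>T\<^esub> x = x \<and> x \<cdot>\<^bsub>T\<^esub> y \<cdot>\<^bsub>T\<^esub> x = x \<cdot>\<^bsub>T\<^esub> y))"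
      then have lrb: "r 1 \<noteq> 0 \<longleftrightarrow> left_regular_band T"
        by (simp add: left_regular_band_def carrier_eq lessThan_def)
      from r have "loaded n T r" by simp
      show "run (pairs_time n (split_time n + 3 + 1 + 1) + 1)
        (Seq (all_pairs (split_test g)) (Store (Const 0) (reg 1))) r (\<lambda>s'. s' 0 \<noteq> 0 \<longleftrightarrow> criterion)"
      proof (rule run_Seq[OF run_all_pairs[OF run_split_test \<open>loaded n T r\<close>]])
        fix q assume q: "loaded n T q \<and> (q 1 \<noteq> 0 \<longleftrightarrow> r 1 \<noteq> 0 \<and>
          (\<forall>x<n. \<forall>y<n. x \<noteq> y \<longrightarrow> (\<exists>e\<le>n. splits T (F x) (stab e) x y)))"
        have "q 1 \<noteq> 0 \<longleftrightarrow> criterion"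
          using q lrb by (simp add: criterion_def principal_filters_eq[OF carrier_eq] carrier_eq Ball_def Bex_def)
        then show "run 1 (Store (Const 0) (reg 1)) q (\<lambda>s'. s' 0 \<noteq> 0 \<longleftrightarrow> criterion)"
          by (intro run_Store) simp
      qed
    qed
  qed
  then show ?thesis by (simp add: criterion_time_def)
qed

end

subsection \<open>Loading the table\<close>

text \<open>
  Every cell with a fixed address belongs to the input table of a large semigroup. The entries for
  the products \<open>0 \<cdot> 0\<close> and \<open>1 \<cdot> 1\<close>, in cells \<open>1\<close> and \<open>n + 2\<close>, are determined by idempotency,
  however; after checking them, these cells can be used to compute \<open>n\<^sup>2\<close> and to move the table.
\<close>

definition load_program :: program where
  "load_program =
     Seq (Store (Const 1) (Const 0))
     (Seq (Store (Add (reg 0) (Const 2)) (reg 0))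
     (Seq (While (Cell (Add (reg 0) (Const 2)))
       (Seq (Store (Const 1) (Add (reg 1) (reg 0)))
         (Store (Add (reg 0) (Const 2)) (Sub (Cell (Add (reg 0) (Const 2))) (Const 1)))))
     (Seq (Store (Add (reg 0) (Const 2)) (Const 1))
     (Seq (While (Sub (reg 1) (Const 1))
       (Seq (Store (Add (reg 1) (Add (Add (reg 0) (reg 0)) (Const 11))) (Cell (reg 1)))
         (Store (Const 1) (Sub (reg 1) (Const 1)))))
     (Seq (Store (Add (Const 12) (Add (reg 0) (reg 0))) (Const 0))
     (Seq (Store (Const 1) (Add (Const 12) (Add (reg 0) (reg 0))))
       (for_loop 2 (reg 0)
         (Seq (Store (Add (Const 11) (Add (reg 2) (reg 2))) (reg 1))
           (Store (Const 1) (Add (reg 1) (reg 0)))))))))))"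

text \<open>\<open>1 - (2 - n)\<close> is the content expected in cell \<open>n + 2\<close>: the
  product \<open>1 \<cdot> 1 = 1\<close> if \<open>n \<ge> 2\<close>, and \<open>0\<close> if
  \<open>n = 1\<close>, when the cell lies behind the table.\<close>

definition decision_program :: "expr \<Rightarrow> program" where
  "decision_program g =
     Cond (Add (reg 1)
         (differ (Cell (Add (reg 0) (Const 2))) (Sub (Const 1) (Sub (Const 2) (reg 0)))))
       (Store (Const 0) (Const 0)) (Seq load_program (criterion_program g))"

definition load_time :: "'a::comm_semiring_1 \<Rightarrow> 'a" where
  "load_time n = 1 + (1 + ((n * (2 + 1) + 1) + (1 + ((n * n * (2 + 1) + 1) +
     (1 + (1 + (n * (2 + 2) + 2)))))))"

definition decision_time :: "'a::comm_semiring_1 \<Rightarrow> 'a" where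
  "decision_time n = 1 + (load_time n + criterion_time n) + 1"

lemma run_load_program:
  assumes n: "0 < n" and 00: "0 \<cdot>\<^bsub>T\<^esub> 0 = (0 :: nat)" and 11: "1 < n \<Longrightarrow> 1 \<cdot>\<^bsub>T\<^esub> 1 = (1 :: nat)"
  shows "run (load_time n) load_program (table_memory n T) (loaded n T)"
proof -
  define M where "M = table_memory n T"
  have M0: "M 0 = n" by (simp add: M_def table_memory_def)
  have entry: "M (1 + i * n + j) = i \<cdot>\<^bsub>T\<^esub> j" if "i < n" "j < n" for i j
    unfolding M_def by (rule table_memory_entry[OF that])
  have M1: "M 1 = 0" using entry[of 0 0] n 00 by simp
  have M2: "M (n + 2) = 1" if "n + 2 \<le> n * n"
  proof -
    have "1 < n" using that by (cases "n = 1") (use n in auto)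
    with entry[of 1 1] 11 show ?thesis by simp
  qed
  \<comment> \<open>Cell \<open>n + 2\<close> counts the additions of \<open>n\<close> to cell 1
    that remain.\<close>
  define square where "square j = M(1 := (n - j) * n, n + 2 := j)" for j
  let ?square_step = "Seq (Store (Const 1) (Add (reg 1) (reg 0)))
         (Store (Add (reg 0) (Const 2)) (Sub (Cell (Add (reg 0) (Const 2))) (Const 1)))"
  have 1: "run (n * (2 + 1) + 1) (While (Cell (Add (reg 0) (Const 2))) ?square_step)
    (square n) (\<lambda>s. s = square 0 \<and> 0 \<le> n)"
  proof (rule run_While[where I = "\<lambda>j s. s = square j \<and> j \<le> n"])
    fix j s assume s: "s = square (Suc j) \<and> Suc j \<le> n"
    then have "s 0 = n" "s (n + 2) = Suc j" "s 1 = (n - Suc j) * n"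
      by (simp_all add: square_def M0)
    moreover have "(n - Suc j) * n + n = (n - j) * n"
      using s by (metis Suc_diff_le add.commute diff_Suc_Suc mult_Suc)
    moreover have "s(1 := (n - j) * n, n + 2 := j) = square j"
      using s by (auto simp: square_def fun_eq_iff)
    ultimately have "expr_val (Cell (Add (reg 0) (Const 2))) s \<noteq> 0"
      "run (1 + 1) ?square_step s (\<lambda>s. s = square j \<and> j \<le> n)"
      using s by (simp, intro run_Store_Seq run_Store) simp
    then show "expr_val (Cell (Add (reg 0) (Const 2))) s \<noteq> 0 \<and>
      run 2 ?square_step s (\<lambda>s. s = square j \<and> j \<le> n)"
      by (simp add: numeral_2_eq_2)
  qed (simp_all add: square_def M0)
  \<comment> \<open>Cell 1 points at the next entry to be moved up by \<open>2 * n + 11\<close>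
    cells. Going downwards, no entry is overwritten before it has been moved.\<close>
  define moved where "moved j s \<longleftrightarrow> s 0 = n \<and> s 1 = j + 1 \<and>
    (\<forall>q. 2 \<le> q \<longrightarrow> q \<le> j + 1 \<longrightarrow> s q = M q) \<and>
    (\<forall>q. j + 1 < q \<longrightarrow> q \<le> n * n \<longrightarrow> s (q + (n + n + 11)) = M q)" for j s
  let ?move_step = "Seq (Store (Add (reg 1) (Add (Add (reg 0) (reg 0)) (Const 11))) (Cell (reg 1)))
         (Store (Const 1) (Sub (reg 1) (Const 1)))"
  have 2: "run ((n * n - 1) * (2 + 1) + 1) (While (Sub (reg 1) (Const 1)) ?move_step) s (moved 0)"
    if "moved (n * n - 1) s" for s
    using that
  proof (rule run_While[where I = moved and N = "n * n - 1", rotated 2])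
    fix j s assume s: "moved (Suc j) s"
    define s' where "s' = s(j + 2 + (n + n + 11) := s (j + 2), 1 := j + 1)"
    have "s (j + 2) = M (j + 2)" using s by (simp add: moved_def)
    then have "moved j s'"
      using s unfolding moved_def s'_def by (auto simp: le_Suc_eq less_Suc_eq)
    moreover have "expr_val (reg 1) s = j + 2" "expr_val (reg 0) s = n"
      using s by (auto simp: moved_def)
    ultimately have "expr_val (Sub (reg 1) (Const 1)) s \<noteq> 0" "run (1 + 1) ?move_step s (moved j)"
      by (simp, intro run_Store_Seq run_Store) (simp add: s'_def)
    then show "expr_val (Sub (reg 1) (Const 1)) s \<noteq> 0 \<and> run 2 ?move_step s (moved j)"
      by (simp add: numeral_2_eq_2)
  qed (simp add: moved_def)
  define rows where "rows i s \<longleftrightarrow> s 0 = n \<and> s 1 = 12 + 2 * n + i * n \<and>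
    (\<forall>k<i. s (11 + 2 * k) = 12 + 2 * n + k * n) \<and>
    (\<forall>k<n. \<forall>j<n. s (12 + 2 * n + k * n + j) = k \<cdot>\<^bsub>T\<^esub> j)" for i s
  let ?row_step = "Seq (Store (Add (Const 11) (Add (reg 2) (reg 2))) (reg 1))
           (Store (Const 1) (Add (reg 1) (reg 0)))"
  have 3: "run (n * (2 + 2) + 2) (for_loop 2 (reg 0) ?row_step) s (rows n)"
    if "rows 0 s" for s
  proof (rule run_for_loop)
    show "rows 0 (s(2 := 0))" using that by (simp add: rows_def)
  next
    fix i s assume s: "i < n" "rows i s" "s 2 = i"
    define s' where "s' = s(11 + 2 * i := s 1, 1 := s 1 + n)"
    have "s' 2 = i \<and> rows (Suc i) (s'(2 := Suc i))"
      using s unfolding rows_def s'_def by (auto simp: less_Suc_eq)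
    moreover have "s(expr_val (Add (Const 11) (Add (reg 2) (reg 2))) s := expr_val (reg 1) s,
        expr_val (Const 1) (s(expr_val (Add (Const 11) (Add (reg 2) (reg 2))) s := expr_val (reg 1) s)) :=
        expr_val (Add (reg 1) (reg 0))
          (s(expr_val (Add (Const 11) (Add (reg 2) (reg 2))) s := expr_val (reg 1) s))) = s'"
      using s unfolding s'_def rows_def by (simp flip: mult_2)
    ultimately have "run (1 + 1) ?row_step s (\<lambda>s'. s' 2 = i \<and> rows (Suc i) (s'(2 := Suc i)))"
      by (intro run_Store_Seq run_Store) (simp only:)
    then show "run 2 ?row_step s (\<lambda>s'. s' 2 = i \<and> rows (Suc i) (s'(2 := Suc i)))"
      by (simp add: numeral_2_eq_2)
  qed (simp add: rows_def)
  have start: "M(expr_val (Const 1) M := expr_val (Const 0) M,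
      expr_val (Add (reg 0) (Const 2)) (M(expr_val (Const 1) M := expr_val (Const 0) M)) :=
      expr_val (reg 0) (M(expr_val (Const 1) M := expr_val (Const 0) M))) = square n"
    by (simp add: square_def M0)
  have moved_start: "moved (n * n - 1) ((square 0)(n + 2 := 1))"
    using n M2 by (auto simp: moved_def square_def M0)
  \<comment> \<open>The entry \<open>0 \<cdot> 0\<close> gave way to the pointer in cell 1; it is
    restored as the constant \<open>0\<close>.\<close>
  have rows_start: "rows 0 (s(12 + 2 * n := 0, 1 := 12 + 2 * n))" if s: "moved 0 s" for s
  proof -
    have "(s(12 + 2 * n := 0)) (12 + 2 * n + k * n + j) = k \<cdot>\<^bsub>T\<^esub> j" if "k < n" "j < n" for k j
    proof (cases "k * n + j = 0")
      case True
      then show ?thesis using 00 n by simp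
    next
      case False
      have "k * n + j < n * n" using that mult_le_mono1[of "Suc k" n n] by simp
      with False have "1 < 1 + k * n + j" "1 + k * n + j \<le> n * n" by simp_all
      moreover have "\<And>q. 1 < q \<Longrightarrow> q \<le> n * n \<Longrightarrow> s (q + (n + n + 11)) = M q"
        using s by (simp add: moved_def)
      ultimately have "s ((1 + k * n + j) + (n + n + 11)) = M (1 + k * n + j)" by blast
      moreover have "(1 + k * n + j) + (n + n + 11) = 12 + 2 * n + k * n + j" by simp
      ultimately have "s (12 + 2 * n + k * n + j) = k \<cdot>\<^bsub>T\<^esub> j" using entry[OF that] by (simp only:)
      moreover have "12 + 2 * n + k * n + j \<noteq> 12 + 2 * n" using False by linarith
      ultimately show ?thesis by (simp only: fun_upd_other not_False_eq_True)
    qed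
    moreover have "s 0 = n" using s by (simp add: moved_def)
    ultimately show ?thesis by (auto simp: rows_def)
  qed
  have "run (1 + (1 + ((n * (2 + 1) + 1) + (1 + (((n * n - 1) * (2 + 1) + 1) +
     (1 + (1 + (n * (2 + 2) + 2)))))))) load_program M (rows n)"
    unfolding load_program_def
  proof (intro run_Store_Seq, unfold start, rule run_Seq[OF 1], rule run_Store_Seq, rule run_Seq[OF 2])
    fix s assume "s = square 0 \<and> 0 \<le> n"
    then show "moved (n * n - 1) (s(expr_val (Add (reg 0) (Const 2)) s := expr_val (Const 1) s))"
      using moved_start M0 by (simp add: square_def)
  next
    fix s assume s: "moved 0 s"
    show "run (1 + (1 + (n * (2 + 2) + 2))) (Seq (Store (Add (Const 12) (Add (reg 0) (reg 0))) (Const 0))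
     (Seq (Store (Const 1) (Add (Const 12) (Add (reg 0) (reg 0))))
       (for_loop 2 (reg 0) ?row_step))) s (rows n)"
    proof (intro run_Store_Seq 3)
      have "s 0 = n" using s by (simp add: moved_def)
      then have eq: "s(expr_val (Add (Const 12) (Add (reg 0) (reg 0))) s := expr_val (Const 0) s) =
          s(12 + 2 * n := 0)"
        and eq': "expr_val (Add (Const 12) (Add (reg 0) (reg 0))) (s(12 + 2 * n := 0)) = 12 + 2 * n"
        by (simp_all flip: mult_2)
      show "rows 0 (s(expr_val (Add (Const 12) (Add (reg 0) (reg 0))) s := expr_val (Const 0) s,
        expr_val (Const 1) (s(expr_val (Add (Const 12) (Add (reg 0) (reg 0))) s := expr_val (Const 0) s)) :=
        expr_val (Add (Const 12) (Add (reg 0) (reg 0)))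
         (s(expr_val (Add (Const 12) (Add (reg 0) (reg 0))) s := expr_val (Const 0) s))))"
        using rows_start[OF s] unfolding eq eq' by (simp only: expr_val.simps(1))
    qed
  qed
  then show ?thesis
    unfolding M_def by (rule run_mono) (auto simp: rows_def loaded_def load_time_def)
qed

context table_program
begin

lemma run_decision_program:
  "run (decision_time n) (decision_program g) (table_memory n T) (\<lambda>s. s 0 \<noteq> 0 \<longleftrightarrow> criterion)"
proof -
  let ?M = "table_memory n T"
  have n: "0 < n" using semigrp.nonempty[OF semigrp] carrier_eq by auto
  have M0: "?M 0 = n" by (simp add: table_memory_def)
  have M1: "?M 1 = 0 \<cdot>\<^bsub>T\<^esub> 0" using table_memory_entry[of 0 n 0 T] n by simp
  have M2: "?M (n + 2) = 1 \<cdot>\<^bsub>T\<^esub> 1" if "1 < n"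
    using table_memory_entry[of 1 n 1 T] that by simp
  have M2': "?M (n + 2) = 0" if "n = 1"
    using that by (simp add: table_memory_def)
  have "expr_val (Add (reg 1)
      (differ (Cell (Add (reg 0) (Const 2))) (Sub (Const 1) (Sub (Const 2) (reg 0))))) ?M = 0 \<longleftrightarrow>
    0 \<cdot>\<^bsub>T\<^esub> 0 = 0 \<and> ?M (n + 2) = 1 - (2 - n)"
    using M0 M1 by simp
  also have "?M (n + 2) = 1 - (2 - n) \<longleftrightarrow> (1 < n \<longrightarrow> 1 \<cdot>\<^bsub>T\<^esub> 1 = 1)"
    using n M2 M2' by (cases "1 < n") (auto simp: not_less le_Suc_eq)
  finally have test: "expr_val (Add (reg 1)
      (differ (Cell (Add (reg 0) (Const 2))) (Sub (Const 1) (Sub (Const 2) (reg 0))))) ?M = 0 \<longleftrightarrow>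
    0 \<cdot>\<^bsub>T\<^esub> 0 = 0 \<and> (1 < n \<longrightarrow> 1 \<cdot>\<^bsub>T\<^esub> 1 = 1)" .
  show ?thesis
    unfolding decision_program_def decision_time_def
  proof (rule run_Cond)
    assume "expr_val (Add (reg 1)
      (differ (Cell (Add (reg 0) (Const 2))) (Sub (Const 1) (Sub (Const 2) (reg 0))))) ?M \<noteq> 0"
    then have "\<not> left_regular_band T"
      using test n carrier_eq by (auto simp: left_regular_band_def)
    then show "run 1 (Store (Const 0) (Const 0)) ?M (\<lambda>s. s 0 \<noteq> 0 \<longleftrightarrow> criterion)"
      by (intro run_Store) (simp add: criterion_def)
  next
    assume "expr_val (Add (reg 1)
      (differ (Cell (Add (reg 0) (Const 2))) (Sub (Const 1) (Sub (Const 2) (reg 0))))) ?M = 0"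
    then show "run (load_time n + criterion_time n) (Seq load_program (criterion_program g)) ?M
      (\<lambda>s. s 0 \<noteq> 0 \<longleftrightarrow> criterion)"
      using test n by (intro run_Seq[OF run_load_program] run_criterion_program) auto
  qed
qed

end

section \<open>Polynomial time for both quasivarieties\<close>

lemma poly_time_decidable_if_criterion:
  fixes F :: "nat sgrp \<Rightarrow> nat \<Rightarrow> nat set"
  assumes K: "\<And>n T. semigrp T \<Longrightarrow> carrier T = {..<n} \<Longrightarrow> T \<in> K \<longleftrightarrow> left_regular_band T \<and>
      (\<forall>x\<in>carrier T. \<forall>y\<in>carrier T. x \<noteq> y \<longrightarrow> (\<exists>Z\<in>principal_filters T. splits T (F T x) Z x y))"
    and guard: "\<And>n T s. semigrp T \<Longrightarrow> carrier T = {..<n} \<Longrightarrow>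
      loaded n T s \<Longrightarrow> s 2 < n \<Longrightarrow> s 6 < n \<Longrightarrow> s 7 < n \<Longrightarrow>
      expr_val g s = 0 \<longleftrightarrow> s 6 \<cdot>\<^bsub>T\<^esub> s 7 \<notin> F T (s 2)"
  shows "poly_time_decidable K"
  unfolding poly_time_decidable_def
\<comment> \<open>\<open>[:0, 1:]\<close> is the indeterminate, so that \<open>poly\<close> turns
  the generic time bound into its value at \<open>n\<close>.\<close>
proof (intro exI[of _ "decision_program g"] exI[of _ "decision_time [:0, 1:]"] allI impI)
  fix n and T :: "nat sgrp" assume T: "semigrp T \<and> carrier T = {..<n}"
  then interpret table_program n T "F T" g
    using guard by (intro table_program.intro) auto
  have "poly (decision_time [:0, 1:]) n = decision_time n"
    by (simp add: decision_time_def load_time_def criterion_time_def split_time_def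
        colour_time_def merge_time_def pairs_time_def)
  with run_decision_program K[of T n] T
  show "\<exists>t s. exec (decision_program g) (table_memory n T) t s \<and>
      t \<le> poly (decision_time [:0, 1:]) n \<and> (s 0 \<noteq> 0 \<longleftrightarrow> T \<in> K)"
    unfolding run_def criterion_def by simp
qed

lemma poly_time_decidable_qv_L: "poly_time_decidable (qv L)"
proof (rule poly_time_decidable_if_criterion[where F = "\<lambda>T x. carrier T" and g = "Const 1"])
  fix n and T :: "nat sgrp" assume T: "semigrp T" "carrier T = {..<n}"
  then show "T \<in> qv L \<longleftrightarrow> left_regular_band T \<and> (\<forall>x\<in>carrier T. \<forall>y\<in>carrier T. x \<noteq> y \<longrightarrow>
      (\<exists>Z\<in>principal_filters T. splits T (carrier T) Z x y))"
    by (intro qv_L_iff) auto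
  fix s :: memory assume "s 6 < n" "s 7 < n"
  then show "expr_val (Const 1) s = 0 \<longleftrightarrow> s 6 \<cdot>\<^bsub>T\<^esub> s 7 \<notin> carrier T"
    using semigrp.closed[OF T(1)] T(2) by auto
qed

text \<open>The guard tests \<open>x \<cdot> (i \<cdot> j) = x\<close>; subtraction from
  \<open>1\<close> negates the inequality test.\<close>

lemma poly_time_decidable_qv_ZL: "poly_time_decidable (qv ZL)"
proof (rule poly_time_decidable_if_criterion[where F = right_stabilizer and
      g = "Sub (Const 1) (differ (product (reg 2) (product (reg 6) (reg 7))) (reg 2))"])
  fix n and T :: "nat sgrp" assume T: "semigrp T" "carrier T = {..<n}"
  then show "T \<in> qv ZL \<longleftrightarrow> left_regular_band T \<and> (\<forall>x\<in>carrier T. \<forall>y\<in>carrier T. x \<noteq> y \<longrightarrow>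
      (\<exists>Z\<in>principal_filters T. splits T (right_stabilizer T x) Z x y))"
    by (intro qv_ZL_iff) auto
  fix s assume s: "loaded n T s" "s 2 < n" "s 6 < n" "s 7 < n"
  have "s 6 \<cdot>\<^bsub>T\<^esub> s 7 < n" using semigrp.closed[OF T(1)] T(2) s by auto
  with s have "expr_val (differ (product (reg 2) (product (reg 6) (reg 7))) (reg 2)) s = 0 \<longleftrightarrow>
      s 6 \<cdot>\<^bsub>T\<^esub> s 7 \<in> right_stabilizer T (s 2)"
    by (simp add: right_stabilizer_def T(2))
  moreover have "expr_val (Sub (Const 1) e) s = 0 \<longleftrightarrow> expr_val e s \<noteq> 0" for e
    by auto
  ultimately show "expr_val (Sub (Const 1) (differ (product (reg 2) (product (reg 6) (reg 7))) (reg 2))) s = 0 \<longleftrightarrow>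
      s 6 \<cdot>\<^bsub>T\<^esub> s 7 \<notin> right_stabilizer T (s 2)"
    by blast
qed

theorem theorem1:
  shows "(\<not> finitely_based (qv L :: 'a::infinite sgrp set) \<and>
          \<not> finitely_based (qv ZL :: 'a sgrp set)) \<and>
         poly_time_decidable (qv L) \<and> poly_time_decidable (qv ZL)"
  using poly_time_decidable_qv_L poly_time_decidable_qv_ZL
    not_finitely_based_between[OF order_refl qv_L_subset_qv_ZL]
    not_finitely_based_between[OF qv_L_subset_qv_ZL order_refl]
  by blast

end
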